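(* Let $\{X(n)\}_{n\ge 0}$ be a stochastically monotone Harris-recurrent Markov process with state space $[0,\infty)$ and stationary transition probabilities such that: C1. The stationary distribution $H(y)=\lim_{n\to\infty}\mathbf{P}^x\{X(n)\le y\}$ exists and its support is $[0,\infty)$. C2. The quasi-stationary distribution $H_A(y)=\lim_{n\to\infty}\mathbf{P}^x\{X(n)\le y \mid N_A^x>n\}$ exists for all $0\le x<A$ and for all $0<A<\infty$. Let $p_A=\mathbf{P}^{H_A}\{X(1)>A\}$. Then: (i) For every fixed $x\in[0,\infty)$, the distribution of $p_A N_A^x$ is asymptotically $\mathrm{Exponential}(1)$ as $A\to\infty$, i.e. $p_A N_A^x$ converges in distribution to an $\mathrm{Exponential}(1)$ random variable. (ii) For every fixed $x\in[0,\infty)$ and every $t<1$, the moment generating function $\mathbf{E}\exp\{t\,p_A N_A^x\}$ of $p_A N_A^x$ converges to $1/(1-t)$ as $A\to\infty$. In particular, $$\lim_{A\to\infty}p_A\,\mathbf{E}N_A^x=1\quad\text{and}\quad \lim_{A\to\infty}\mathrm{Variance}\{p_A N_A^x\}=1 .$$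
   Context: $\{X(n)\}$, $n=0,1,2,\dots$, is a discrete-time time-homogeneous Markov process. $\mathbf{P}^x$ denotes the probability measure of the process started at $X(0)=x$, and $\mathbf{P}^G$ the probability measure when the initial state $X(0)$ has distribution $G$. The process is called stochastically monotone if $\mathbf{P}^x(X(1)\ge y)$ is non-decreasing and right-continuous in $x$ for all $y$. For a finite threshold $A>0$ and $0\le x<A$, the first exit time from $[0,A]$ is $$N_A^x=\min\{n\ge 1: X(n)>A\},\qquad X(0)=x .$$ The limits $H$ and $H_A$ in C1 and C2 are (distribution functions of) probability distributions on $[0,\infty)$ and $[0,A]$ respectively, not depending on the starting point $x$. *)

theory Defs
  imports "HOL-Probability.Probability"
begin

text \<open>The state space $[0,\infty)$ with its Borel sets. Its measurable sets are subsets of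
  $[0,\infty)$, so the distribution function of a law \<open>M\<close> on it is written
  \<open>\<P>(z in M. z \<le> y)\<close>, not \<open>cdf M y\<close> (the set \<open>{..y}\<close> is never measurable here).\<close>

definition halfline :: "real measure" where
  "halfline = restrict_space borel {0..}"

definition natural_filtration ::
    "'w measure \<Rightarrow> (nat \<Rightarrow> 'w \<Rightarrow> real) \<Rightarrow> nat \<Rightarrow> 'w measure" where
  "natural_filtration M X n =
     vimage_algebra (space M) (\<lambda>\<omega>. \<lambda>i\<in>{..n}. X i \<omega>) (Pi\<^sub>M {..n} (\<lambda>_. halfline))"

text \<open>Under the probability measure \<open>M\<close>, the process \<open>X\<close> has initial law \<open>G\<close> and satisfies the
  Markov property with the transition kernel \<open>K\<close>, the same at every time.\<close>

definition markov_law ::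
    "(real \<Rightarrow> real measure) \<Rightarrow> real measure \<Rightarrow> 'w measure \<Rightarrow> (nat \<Rightarrow> 'w \<Rightarrow> real) \<Rightarrow> bool" where
  "markov_law K G M X \<longleftrightarrow>
     prob_space M \<and>
     (\<forall>n. X n \<in> M \<rightarrow>\<^sub>M halfline) \<and>
     distr M halfline (X 0) = G \<and>
     (\<forall>n. \<forall>B \<in> sets halfline.
        AE \<omega> in M. real_cond_exp M (natural_filtration M X n) (\<lambda>\<omega>. indicator B (X (Suc n) \<omega>)) \<omega>
                     = measure (K (X n \<omega>)) B)"

text \<open>\<open>P G\<close> is the measure written $\mathbf{P}^G$; \<open>start P x\<close> is $\mathbf{P}^x$.\<close>

definition markov_process ::
    "(real \<Rightarrow> real measure) \<Rightarrow> (real measure \<Rightarrow> 'w measure) \<Rightarrow> (nat \<Rightarrow> 'w \<Rightarrow> real) \<Rightarrow> bool" where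
  "markov_process K P X \<longleftrightarrow>
     K \<in> halfline \<rightarrow>\<^sub>M prob_algebra halfline \<and>
     (\<forall>G \<in> space (prob_algebra halfline). markov_law K G (P G) X)"

definition start :: "(real measure \<Rightarrow> 'w measure) \<Rightarrow> real \<Rightarrow> 'w measure" where
  "start P x = P (return halfline x)"

definition stochastically_monotone ::
    "(real measure \<Rightarrow> 'w measure) \<Rightarrow> (nat \<Rightarrow> 'w \<Rightarrow> real) \<Rightarrow> bool" where
  "stochastically_monotone P X \<longleftrightarrow>
     (\<forall>y. mono_on {0..} (\<lambda>x. \<P>(\<omega> in start P x. X 1 \<omega> \<ge> y)) \<and>
          (\<forall>x\<ge>0. continuous (at_right x) (\<lambda>x. \<P>(\<omega> in start P x. X 1 \<omega> \<ge> y))))"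

definition harris_recurrent ::
    "(real measure \<Rightarrow> 'w measure) \<Rightarrow> (nat \<Rightarrow> 'w \<Rightarrow> real) \<Rightarrow> bool" where
  "harris_recurrent P X \<longleftrightarrow>
     (\<exists>\<phi>. sigma_finite_measure \<phi> \<and> sets \<phi> = sets halfline \<and> emeasure \<phi> (space \<phi>) \<noteq> 0 \<and>
        (\<forall>B \<in> sets halfline. emeasure \<phi> B \<noteq> 0 \<longrightarrow>
           (\<forall>x\<ge>0. AE \<omega> in start P x. infinite {n. X n \<omega> \<in> B})))"

definition measure_support :: "'a::topological_space measure \<Rightarrow> 'a set" where
  "measure_support M =
     {x \<in> space M. \<forall>U. open U \<longrightarrow> x \<in> U \<longrightarrow> emeasure M (U \<inter> space M) \<noteq> 0}"

definition exit_time :: "(nat \<Rightarrow> 'w \<Rightarrow> real) \<Rightarrow> real \<Rightarrow> 'w \<Rightarrow> enat" where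
  "exit_time X A \<omega> = Inf {enat n | n. 1 \<le> n \<and> X n \<omega> > A}"

text \<open>The value on the event that the exit time is infinite is irrelevant where this is used,
  since the exit time is then asserted to be finite almost surely.\<close>

definition exit_time_real :: "(nat \<Rightarrow> 'w \<Rightarrow> real) \<Rightarrow> real \<Rightarrow> 'w \<Rightarrow> real" where
  "exit_time_real X A \<omega> = real (the_enat (exit_time X A \<omega>))"

definition stationary ::
    "(real measure \<Rightarrow> 'w measure) \<Rightarrow> (nat \<Rightarrow> 'w \<Rightarrow> real) \<Rightarrow> real measure \<Rightarrow> bool" where
  "stationary P X H \<longleftrightarrow>
     H \<in> space (prob_algebra halfline) \<and> (\<forall>n. distr (P H) halfline (X n) = H)"

definition quasi_stationary ::
    "(real measure \<Rightarrow> 'w measure) \<Rightarrow> (nat \<Rightarrow> 'w \<Rightarrow> real) \<Rightarrow> real \<Rightarrow> real measure \<Rightarrow> bool" where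
  "quasi_stationary P X A Q \<longleftrightarrow>
     Q \<in> space (prob_algebra halfline) \<and> measure Q {0..A} = 1 \<and>
     (\<forall>n. \<forall>B \<in> sets halfline.
        \<P>(\<omega> in P Q. X n \<omega> \<in> B \<bar> exit_time X A \<omega> > enat n) = measure Q B)"

text \<open>The condition of \<open>weak_conv_m\<close>, for a family indexed along an arbitrary filter instead of a
  sequence.\<close>

definition weak_conv_along :: "('i \<Rightarrow> real measure) \<Rightarrow> real measure \<Rightarrow> 'i filter \<Rightarrow> bool" where
  "weak_conv_along \<mu> \<nu> F \<longleftrightarrow>
     (\<forall>s. isCont (cdf \<nu>) s \<longrightarrow> ((\<lambda>i. cdf (\<mu> i) s) \<longlongrightarrow> cdf \<nu> s) F)"

end

(* The survival probabilities P^x(N_A > n) are nonincreasing in x by stochastic monotonicity, and under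
   P^{H_A} they equal (1 - p_A)^n exactly, by quasi-stationarity. Since conditioning on {N_A > n} lowers
   X(n) stochastically (association of monotone chains), H_A is dominated by H. This gives
   p_A <= H((A, oo)) -> 0 and traps the geometric law between P^0(N_A > n) and, up to the factor
   H([0, z]), P^z(N_A > n). These two survival probabilities differ by at most the probability that
   the chain from z leaves [0, A] before an independent chain from 0 has overtaken it; overtaking
   happens almost surely because both chains converge to the nondegenerate H, so the difference tends
   to 0 uniformly in n. Hence P^x(N_A > n) = (1 - p_A)^n + o(1) uniformly in n. Submultiplicativity of
   P^0(N_A > n) then upgrades the case n ~ 1 / p_A to a uniform bound C e^{-r p_A n} for each r < 1, and
   dominated convergence yields the exponential and power moments. *)

theory Submission
  imports Defs
begin

section \<open>Laws on the half-line and stochastic order\<close>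

text \<open>The process lives on an abstract space that need not carry two independent copies of the
  chain, so hardly any argument takes place on paths. Survival up to time \<open>n\<close> together
  with the position at \<open>n\<close> is expressed by iterating a kernel operator on functions of
  the starting point. The coupling becomes a recursion on functions of two states, and association
  along a path reduces to Chebyshev's inequality in one real variable, applied to one step at a
  time.

  Quasi-stationarity describes the exit time only on average over \<open>HA A\<close>, a law that
  moves with \<open>A\<close>. The difficulty is to reach a fixed starting point with an error
  uniform in \<open>n\<close>, because the relevant \<open>n\<close> is of order
  \<open>1 / p A\<close> and \<open>p A\<close> vanishes at an unknown rate. Two facts help:
  \<open>HA A\<close> keeps mass close to 1 on a fixed interval \<open>[0, z]\<close>, and the
  meeting time of two fixed starting points does not depend on \<open>A\<close>. The horizon of the
  coupling is therefore chosen first, and \<open>A\<close> afterwards so large that an exit before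
  that horizon is unlikely.\<close>

lemma space_halfline [simp]: "space halfline = {0..}"
  by (simp add: halfline_def space_restrict_space)

lemma sets_halfline: "B \<in> sets halfline \<longleftrightarrow> B \<in> sets borel \<and> B \<subseteq> {0..}"
  unfolding halfline_def by (subst sets_restrict_space_iff) auto

lemma borel_measurable_halfline: "f \<in> borel_measurable borel \<Longrightarrow> f \<in> borel_measurable halfline"
  unfolding halfline_def by (rule measurable_restrict_space1)

lemma in_prob_algebra_halfline:
  assumes "\<mu> \<in> space (prob_algebra halfline)"
  shows "prob_space \<mu>" "sets \<mu> = sets halfline" "space \<mu> = {0..}"
proof -
  show "prob_space \<mu>" "sets \<mu> = sets halfline"
    using assms by (auto simp: space_prob_algebra)
  then show "space \<mu> = {0..}" using sets_eq_imp_space_eq[of \<mu> halfline] by simp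
qed

text \<open>Fubini for \<open>g s\<close> over the region \<open>0 \<le> s < Y \<omega>\<close>:
  integrating over \<open>s\<close> first gives \<open>G (Y \<omega>) - G 0\<close> by the
  fundamental theorem of calculus, integrating over \<open>\<omega>\<close> first gives the tail
  probability. With \<open>G\<close> the identity this is the layer-cake formula behind stochastic
  order; with exponentials and powers it yields the moments of the exit time.\<close>

lemma tail_integral:
  fixes Y :: "'a \<Rightarrow> real" and G g :: "real \<Rightarrow> real"
  assumes "prob_space M" and Y [measurable]: "Y \<in> borel_measurable M"
    and Y_nonneg: "\<And>\<omega>. \<omega> \<in> space M \<Longrightarrow> 0 \<le> Y \<omega>"
    and deriv: "\<And>s. (G has_real_derivative g s) (at s)" and cont: "\<And>s. isCont g s"
    and int: "integrable lborel (\<lambda>s. indicator {0..} s * \<bar>g s\<bar> * \<P>(\<omega> in M. s < Y \<omega>))"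
  shows "integrable M (\<lambda>\<omega>. G (Y \<omega>))"
    and "(\<integral>\<omega>. G (Y \<omega>) \<partial>M)
           = G 0 + (\<integral>s. indicator {0..} s * g s * \<P>(\<omega> in M. s < Y \<omega>) \<partial>lborel)"
proof -
  interpret prob_space M by fact
  interpret pair_sigma_finite lborel M ..
  have [measurable]: "g \<in> borel_measurable borel"
    using cont by (intro borel_measurable_continuous_onI continuous_at_imp_continuous_on) auto
  define F where "F s \<omega> = indicator {0..} s * g s * (if s < Y \<omega> then 1 else 0)" for s \<omega>
  have F_meas: "case_prod F \<in> borel_measurable (lborel \<Otimes>\<^sub>M M)"
    unfolding F_def by measurable
  have inner: "(\<integral>\<omega>. c * (if s < Y \<omega> then 1 else 0) \<partial>M) = c * \<P>(\<omega> in M. s < Y \<omega>)" for c s :: real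
  proof -
    have "(\<integral>\<omega>. (if s < Y \<omega> then 1 else 0) \<partial>M) = (\<integral>\<omega>. indicator {\<omega> \<in> space M. s < Y \<omega>} \<omega> \<partial>M)"
      by (rule Bochner_Integration.integral_cong) auto
    also have "\<dots> = \<P>(\<omega> in M. s < Y \<omega>)"
      by (subst Bochner_Integration.integral_indicator) (auto intro!: arg_cong[where f=prob])
    finally show ?thesis by simp
  qed
  have F_int: "integrable (lborel \<Otimes>\<^sub>M M) (case_prod F)"
  proof (rule Fubini_integrable)
    show "integrable lborel (\<lambda>s. \<integral>\<omega>. norm (case_prod F (s, \<omega>)) \<partial>M)"
    proof -
      have "(\<lambda>s. \<integral>\<omega>. norm (case_prod F (s, \<omega>)) \<partial>M)
          = (\<lambda>s. \<integral>\<omega>. (indicator {0..} s * \<bar>g s\<bar>) * (if s < Y \<omega> then 1 else 0) \<partial>M)"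
        unfolding F_def by (intro ext Bochner_Integration.integral_cong) (auto simp: abs_mult)
      then show ?thesis using int by (simp only: inner)
    qed
    have "integrable M (F s)" for s
      by (rule integrable_const_bound[where B="\<bar>g s\<bar>"])
        (simp add: F_def split: split_indicator, unfold F_def, measurable)
    then show "AE s in lborel. integrable M (\<lambda>\<omega>. case_prod F (s, \<omega>))" by simp
  qed (rule F_meas)
  have F_inner: "(\<integral>s. F s \<omega> \<partial>lborel) = G (Y \<omega>) - G 0" if "\<omega> \<in> space M" for \<omega>
  proof -
    have "(\<integral>s. F s \<omega> \<partial>lborel) = (\<integral>s. g s * indicator {0..Y \<omega>} s \<partial>lborel)"
    proof (rule integral_cong_AE)
      \<comment> \<open>The strict inequality in \<open>F\<close> and the closed interval disagree
        only at the null point \<open>s = Y \<omega>\<close>.\<close>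
      show "AE s in lborel. F s \<omega> = g s * indicator {0..Y \<omega>} s"
        using AE_lborel_singleton[of "Y \<omega>"] by eventually_elim (auto simp: F_def split: split_indicator)
      show "(\<lambda>s. F s \<omega>) \<in> borel_measurable lborel" unfolding F_def by measurable
    qed measurable
    then show ?thesis
      using integral_FTC_Icc_real[OF Y_nonneg[OF that], of G g] deriv cont by simp
  qed
  have "integrable M (\<lambda>\<omega>. \<integral>s. F s \<omega> \<partial>lborel)"
    using integrable_snd[OF F_int] .
  then have "integrable M (\<lambda>\<omega>. G (Y \<omega>) - G 0)"
    using F_inner by (simp cong: Bochner_Integration.integrable_cong)
  from Bochner_Integration.integrable_add[OF this, of "\<lambda>_. G 0"]
  show GY: "integrable M (\<lambda>\<omega>. G (Y \<omega>))" by simp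
  have "(\<integral>\<omega>. G (Y \<omega>) \<partial>M) - G 0 = (\<integral>\<omega>. G (Y \<omega>) - G 0 \<partial>M)"
    using GY by (simp add: prob_space)
  also have "\<dots> = (\<integral>\<omega>. \<integral>s. F s \<omega> \<partial>lborel \<partial>M)"
    using F_inner by (intro Bochner_Integration.integral_cong) auto
  also have "\<dots> = (\<integral>s. \<integral>\<omega>. F s \<omega> \<partial>M \<partial>lborel)"
    using Fubini_integral[OF F_int] .
  also have "\<dots> = (\<integral>s. indicator {0..} s * g s * \<P>(\<omega> in M. s < Y \<omega>) \<partial>lborel)"
    unfolding F_def by (simp only: inner)
  finally show "(\<integral>\<omega>. G (Y \<omega>) \<partial>M)
      = G 0 + (\<integral>s. indicator {0..} s * g s * \<P>(\<omega> in M. s < Y \<omega>) \<partial>lborel)" by simp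
qed

text \<open>Confining test functions to \<open>[0, 1]\<close> makes them integrable against every
  law and keeps the class closed under products, \<open>1 - f\<close> and kernel integration. Values
  at negative arguments stay free, as those points lie outside \<open>halfline\<close>.\<close>

definition unit_fun :: "(real \<Rightarrow> real) \<Rightarrow> bool" where
  "unit_fun f \<longleftrightarrow> f \<in> borel_measurable halfline \<and> (\<forall>x\<ge>0. 0 \<le> f x \<and> f x \<le> 1)"

lemma unit_funD:
  assumes "unit_fun f"
  shows "f \<in> borel_measurable halfline" "0 \<le> x \<Longrightarrow> 0 \<le> f x" "0 \<le> x \<Longrightarrow> f x \<le> 1"
  using assms by (auto simp: unit_fun_def)

lemma unit_fun_const: "0 \<le> c \<Longrightarrow> c \<le> 1 \<Longrightarrow> unit_fun (\<lambda>_. c)"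
  by (simp add: unit_fun_def)

lemma unit_fun_indicator: "C \<in> sets borel \<Longrightarrow> unit_fun (indicator C)"
  by (auto simp: unit_fun_def indicator_def intro!: borel_measurable_halfline)

lemma unit_fun_mult: "unit_fun f \<Longrightarrow> unit_fun g \<Longrightarrow> unit_fun (\<lambda>x. f x * g x)"
  unfolding unit_fun_def by (intro conjI borel_measurable_times) (simp_all add: mult_le_one)

lemma unit_fun_diff: "unit_fun f \<Longrightarrow> unit_fun (\<lambda>x. 1 - f x)"
  unfolding unit_fun_def by (intro conjI borel_measurable_diff) simp_all

lemma integrable_unit_fun:
  assumes \<mu>: "\<mu> \<in> space (prob_algebra halfline)" and f: "unit_fun f"
  shows "integrable \<mu> f"
proof -
  interpret prob_space \<mu> using in_prob_algebra_halfline[OF \<mu>] by simp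
  have "f \<in> borel_measurable \<mu>"
    using unit_funD(1)[OF f] in_prob_algebra_halfline(2)[OF \<mu>] by (simp cong: measurable_cong_sets)
  then show ?thesis
    using in_prob_algebra_halfline(3)[OF \<mu>] unit_funD(2,3)[OF f]
    by (intro integrable_const_bound[where B=1]) auto
qed

lemma integral_unit_fun_mono:
  assumes \<mu>: "\<mu> \<in> space (prob_algebra halfline)" and f: "unit_fun f" and g: "unit_fun g"
    and le: "\<And>x. 0 \<le> x \<Longrightarrow> f x \<le> g x"
  shows "(\<integral>z. f z \<partial>\<mu>) \<le> (\<integral>z. g z \<partial>\<mu>)"
  using integrable_unit_fun[OF \<mu>] f g le in_prob_algebra_halfline(3)[OF \<mu>]
  by (intro integral_mono) auto

lemma integral_unit_fun_bounds:
  assumes \<mu>: "\<mu> \<in> space (prob_algebra halfline)" and f: "unit_fun f"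
  shows "0 \<le> (\<integral>z. f z \<partial>\<mu>)" "(\<integral>z. f z \<partial>\<mu>) \<le> 1"
proof -
  interpret prob_space \<mu> using in_prob_algebra_halfline[OF \<mu>] by simp
  show "0 \<le> (\<integral>z. f z \<partial>\<mu>)"
    using unit_funD(2)[OF f] by (intro Bochner_Integration.integral_nonneg) (auto simp: in_prob_algebra_halfline(3)[OF \<mu>])
  show "(\<integral>z. f z \<partial>\<mu>) \<le> 1"
    using integral_unit_fun_mono[OF \<mu> f unit_fun_const[of 1]] unit_funD(3)[OF f]
    by (simp only: lebesgue_integral_const prob_space) simp
qed

text \<open>A nonempty bounded down-set of the half-line is \<open>{0..a}\<close> or
  \<open>{0..<a}\<close>, and the second is an increasing union of intervals \<open>{0..b}\<close>,
  to which the hypothesis applies.\<close>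

lemma measure_le_of_down_set:
  assumes \<mu>: "\<mu> \<in> space (prob_algebra halfline)" and \<nu>: "\<nu> \<in> space (prob_algebra halfline)"
    and cdf_le: "\<And>y. measure \<nu> {0..y} \<le> measure \<mu> {0..y}"
    and D: "D \<subseteq> {0..}" and down: "\<And>x y. 0 \<le> x \<Longrightarrow> x \<le> y \<Longrightarrow> y \<in> D \<Longrightarrow> x \<in> D"
  shows "measure \<nu> D \<le> measure \<mu> D"
proof -
  interpret \<mu>: prob_space \<mu> using in_prob_algebra_halfline[OF \<mu>] by simp
  interpret \<nu>: prob_space \<nu> using in_prob_algebra_halfline[OF \<nu>] by simp
  note sets = in_prob_algebra_halfline(2)[OF \<mu>] in_prob_algebra_halfline(2)[OF \<nu>]
  consider "D = {}" | "\<not> bdd_above D" | "D \<noteq> {}" "bdd_above D" by blast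
  then show ?thesis
  proof cases
    case 2
    then have "D = {0..}"
      using D down unfolding bdd_above_def by (auto, meson linear)
    then show ?thesis
      using \<mu>.prob_space \<nu>.prob_space in_prob_algebra_halfline(3)[OF \<mu>] in_prob_algebra_halfline(3)[OF \<nu>]
      by simp
  next
    case 3
    define a where "a = Sup D"
    have le: "x \<in> D \<Longrightarrow> x \<le> a" for x
      using 3 by (simp add: a_def cSup_upper)
    have lt: "x \<in> D" if x: "0 \<le> x" "x < a" for x
    proof -
      obtain y where "y \<in> D" "x < y" using less_cSupD[OF 3(1)] x(2) unfolding a_def by blast
      then show ?thesis using down[of x y] x by auto
    qed
    show ?thesis
    proof (cases "a \<in> D")
      case True
      have "D = {0..a}"
      proof
        show "D \<subseteq> {0..a}" using le D by auto
        show "{0..a} \<subseteq> D" using down[OF _ _ True] by auto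
      qed
      then show ?thesis using cdf_le by simp
    next
      case False
      define E where "E n = {0..a - 1 / Suc n}" for n :: nat
      have DE: "D = (\<Union>n. E n)"
      proof
        show "D \<subseteq> (\<Union>n. E n)"
        proof
          fix x assume x: "x \<in> D"
          then have "0 < a - x" using le[of x] False by (cases "x = a") auto
          then obtain n where "1 / Suc n < a - x" using nat_approx_posE by blast
          then have "x \<in> E n" using x D by (auto simp: E_def)
          then show "x \<in> (\<Union>n. E n)" by auto
        qed
        show "(\<Union>n. E n) \<subseteq> D"
        proof
          fix x assume "x \<in> (\<Union>n. E n)"
          then obtain n where "0 \<le> x" "x \<le> a - 1 / Suc n" by (auto simp: E_def)
          moreover have "0 < 1 / real (Suc n)" by simp
          ultimately show "x \<in> D" by (intro lt) linarith+
        qed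
      qed
      have inc: "incseq E"
      proof (rule incseq_SucI)
        fix n
        have "1 / real (Suc (Suc n)) \<le> 1 / real (Suc n)" by (simp add: field_simps)
        then show "E n \<subseteq> E (Suc n)" unfolding E_def by (intro atLeastatMost_subset_iff[THEN iffD2]) linarith
      qed
      have "range E \<subseteq> sets halfline"
        by (auto simp: E_def sets_halfline)
      then have "(\<lambda>n. measure \<mu> (E n)) \<longlonglongrightarrow> measure \<mu> D" "(\<lambda>n. measure \<nu> (E n)) \<longlonglongrightarrow> measure \<nu> D"
        unfolding DE using inc sets
        by (auto intro!: \<mu>.finite_Lim_measure_incseq \<nu>.finite_Lim_measure_incseq)
      then show ?thesis
        by (intro LIMSEQ_le[of "\<lambda>n. measure \<nu> (E n)" _ "\<lambda>n. measure \<mu> (E n)"]) (auto simp: E_def cdf_le)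
    qed
  qed simp
qed

text \<open>The superlevel sets of a decreasing function are down-sets, so the two laws compare
  level by level; the layer-cake formula integrates this over the levels.\<close>

lemma integral_le_of_stoch_le:
  assumes \<mu>: "\<mu> \<in> space (prob_algebra halfline)" and \<nu>: "\<nu> \<in> space (prob_algebra halfline)"
    and cdf_le: "\<And>y. measure \<nu> {0..y} \<le> measure \<mu> {0..y}"
    and f: "unit_fun f" and anti: "antimono_on {0..} f"
  shows "(\<integral>z. f z \<partial>\<nu>) \<le> (\<integral>z. f z \<partial>\<mu>)"
proof -
  let ?m = "\<lambda>\<mu> s. \<P>(z in \<mu>. s < f z)"
  have layer: "integrable lborel (\<lambda>s. indicator {0..} s * ?m \<mu> s)"
     "(\<integral>z. f z \<partial>\<mu>) = (\<integral>s. indicator {0..} s * ?m \<mu> s \<partial>lborel)"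
    if \<mu>: "\<mu> \<in> space (prob_algebra halfline)" for \<mu>
  proof -
    note H = in_prob_algebra_halfline[OF \<mu>]
    interpret prob_space \<mu> by (rule H)
    have [measurable]: "f \<in> borel_measurable \<mu>"
      using unit_funD(1)[OF f] H(2) by (simp cong: measurable_cong_sets)
    have m: "(\<lambda>s. ?m \<mu> s) \<in> borel_measurable borel"
    proof -
      have "mono (\<lambda>s. - ?m \<mu> s)"
        by (intro monoI le_imp_neg_le finite_measure_mono) auto
      then have "(\<lambda>s. - ?m \<mu> s) \<in> borel_measurable borel" by (rule borel_measurable_mono)
      then show ?thesis by simp
    qed
    show int: "integrable lborel (\<lambda>s. indicator {0..} s * ?m \<mu> s)"
    proof (rule Bochner_Integration.integrable_bound)
      show "integrable lborel (indicator {0..1::real} :: real \<Rightarrow> real)" by simp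
      have "?m \<mu> s = 0" if "1 < s" for s
      proof -
        have "{z \<in> space \<mu>. s < f z} = {}" using unit_funD(3)[OF f] that H(3) by force
        then show ?thesis by (simp only: measure_empty)
      qed
      then show "AE s in lborel. norm (indicator {0..} s * ?m \<mu> s) \<le> norm (indicator {0..1} s :: real)"
        by (intro AE_I2) (auto split: split_indicator)
    qed (use m in measurable)
    show "(\<integral>z. f z \<partial>\<mu>) = (\<integral>s. indicator {0..} s * ?m \<mu> s \<partial>lborel)"
      using tail_integral(2)[of \<mu> f "\<lambda>s. s" "\<lambda>_. 1"] prob_space_axioms unit_funD(2)[OF f] int
      by (simp add: H(3))
  qed
  have "?m \<nu> s \<le> ?m \<mu> s" for s
  proof -
    have eq: "{z \<in> space \<mu>. s < f z} = {z. 0 \<le> z \<and> s < f z}" "{z \<in> space \<nu>. s < f z} = {z. 0 \<le> z \<and> s < f z}"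
      using in_prob_algebra_halfline(3)[OF \<mu>] in_prob_algebra_halfline(3)[OF \<nu>] by auto
    show ?thesis unfolding eq
    proof (rule measure_le_of_down_set[OF \<mu> \<nu> cdf_le])
      fix x y assume "0 \<le> x" "x \<le> y" "y \<in> {z. 0 \<le> z \<and> s < f z}"
      then show "x \<in> {z. 0 \<le> z \<and> s < f z}"
        using monotone_onD[OF anti, of x y] by auto
    qed auto
  qed
  then show ?thesis
    unfolding layer(2)[OF \<mu>] layer(2)[OF \<nu>]
    by (intro integral_mono layer \<mu> \<nu>) (auto split: split_indicator)
qed

text \<open>Subtracting from \<open>f\<close> its value at the place where \<open>g\<close> crosses its mean makes
  \<open>(f - c) * (g - \<integral>g)\<close> nonnegative pointwise.\<close>

lemma chebyshev_association:
  assumes \<mu>: "\<mu> \<in> space (prob_algebra halfline)"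
    and f: "unit_fun f" and anti_f: "antimono_on {0..} f"
    and g: "unit_fun g" and anti_g: "antimono_on {0..} g"
  shows "(\<integral>z. f z \<partial>\<mu>) * (\<integral>z. g z \<partial>\<mu>) \<le> (\<integral>z. f z * g z \<partial>\<mu>)"
proof -
  note H = in_prob_algebra_halfline[OF \<mu>]
  interpret prob_space \<mu> by (rule H)
  define m where "m = (\<integral>z. g z \<partial>\<mu>)"
  have "\<exists>c. \<forall>z\<ge>0. 0 \<le> (f z - c) * (g z - m)"
  proof (cases "\<exists>w\<ge>0. g w < m")
    \<comment> \<open>If \<open>g\<close> never drops below its mean, the second factor is
      nonnegative everywhere and \<open>c = 0\<close> suffices because \<open>f\<close> is
      nonnegative.\<close>
    case False
    then show ?thesis
      using unit_funD(2)[OF f] by (intro exI[of _ 0]) (auto simp: not_less)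
  next
    case True
    define S where "S = f ` {w. 0 \<le> w \<and> g w < m}"
    have S: "S \<noteq> {}" "bdd_above S" using True unit_funD(3)[OF f] by (auto simp: S_def bdd_above_def)
    have "0 \<le> (f z - Sup S) * (g z - m)" if z: "0 \<le> z" for z
    proof (cases "g z < m")
      case True
      then have "f z \<le> Sup S" using z S by (intro cSup_upper) (auto simp: S_def)
      with True show ?thesis by (simp add: mult_nonpos_nonpos)
    next
      case False
      have "Sup S \<le> f z"
      proof (rule cSup_least[OF S(1)])
        fix v assume "v \<in> S"
        then obtain w where w: "0 \<le> w" "g w < m" "v = f w" by (auto simp: S_def)
        \<comment> \<open>Points where \<open>g\<close> is below its mean lie to the right of those
          where it is not.\<close>
        have "z \<le> w"
        proof (rule ccontr)
          assume "\<not> z \<le> w"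
          then have "g z \<le> g w" using monotone_onD[OF anti_g, of w z] w z by simp
          then show False using False w by simp
        qed
        then show "v \<le> f z" using monotone_onD[OF anti_f, of z w] w z by auto
      qed
      with False show ?thesis by simp
    qed
    then show ?thesis by blast
  qed
  then obtain c where c: "0 \<le> (f z - c) * (g z - m)" if "0 \<le> z" for z by blast
  have [simp]: "integrable \<mu> f" "integrable \<mu> g" "integrable \<mu> (\<lambda>z. f z * g z)"
    using integrable_unit_fun[OF \<mu>] f g unit_fun_mult by auto
  have "0 \<le> (\<integral>z. f z * g z - (m * f z + c * g z - c * m) \<partial>\<mu>)"
    using c by (intro Bochner_Integration.integral_nonneg) (auto simp: H(3) algebra_simps)
  also have "(\<integral>z. f z * g z - (m * f z + c * g z - c * m) \<partial>\<mu>)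
      = (\<integral>z. f z * g z \<partial>\<mu>) - (m * (\<integral>z. f z \<partial>\<mu>) + c * m - c * m)"
    by (simp add: prob_space m_def)
  finally show ?thesis by (simp add: m_def mult.commute)
qed

section \<open>The chain killed outside a set\<close>

text \<open>Time 0 carries no condition, so the starting point may lie anywhere. Since the infimum
  of the empty set is infinite, paths that never exceed \<open>A\<close> are covered as
  well.\<close>

lemma exit_time_gt_iff: "enat n < exit_time X A \<omega> \<longleftrightarrow> (\<forall>i\<in>{1..n}. X i \<omega> \<le> A)"
proof -
  let ?S = "{enat n |n. 1 \<le> n \<and> A < X n \<omega>}"
  have "enat n < exit_time X A \<omega> \<longleftrightarrow> (\<forall>m. 1 \<le> m \<and> A < X m \<omega> \<longrightarrow> n < m)"
  proof
    assume *: "enat n < exit_time X A \<omega>"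
    have "exit_time X A \<omega> \<le> enat m" if "1 \<le> m \<and> A < X m \<omega>" for m
      unfolding exit_time_def using that by (intro Inf_lower) auto
    from less_le_trans[OF * this] show "\<forall>m. 1 \<le> m \<and> A < X m \<omega> \<longrightarrow> n < m" by auto
  next
    assume *: "\<forall>m. 1 \<le> m \<and> A < X m \<omega> \<longrightarrow> n < m"
    have "enat (Suc n) \<le> Inf ?S"
      using * by (intro Inf_greatest) (auto simp: Suc_le_eq)
    then show "enat n < exit_time X A \<omega>"
      unfolding exit_time_def by (rule less_le_trans[rotated]) simp
  qed
  also have "\<dots> \<longleftrightarrow> (\<forall>i\<in>{1..n}. X i \<omega> \<le> A)"
    by (meson atLeastAtMost_iff not_le)
  finally show ?thesis .
qed

locale halfline_kernel =
  fixes K :: "real \<Rightarrow> real measure"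
  assumes K_measurable: "K \<in> halfline \<rightarrow>\<^sub>M prob_algebra halfline"
begin

text \<open>The transition operator killed outside \<open>C\<close>, with the test at the arrival
  point to match exit times that start counting at 1: \<open>(taboo C ^^ n) f x\<close> is the
  expectation of \<open>f (X n)\<close> from \<open>x\<close> on the event that
  \<open>X 1, ..., X n\<close> lie in \<open>C\<close>. For \<open>C = UNIV\<close> it is the
  ordinary transition operator.\<close>

definition taboo :: "real set \<Rightarrow> (real \<Rightarrow> real) \<Rightarrow> real \<Rightarrow> real" where
  "taboo C f x = (\<integral>z. indicator C z * f z \<partial>K x)"

lemma kernel_at: "0 \<le> x \<Longrightarrow> K x \<in> space (prob_algebra halfline)"
  using measurable_space[OF K_measurable] by simp

lemmas K_measurable' = measurable_prob_algebraD[OF K_measurable]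

lemma unit_fun_integral:
  assumes f: "unit_fun f"
  shows "unit_fun (\<lambda>x. \<integral>z. f z \<partial>K x)"
  unfolding unit_fun_def
proof (intro conjI allI impI)
  show "(\<lambda>x. \<integral>z. f z \<partial>K x) \<in> borel_measurable halfline"
    by (rule measurable_compose[OF K_measurable' integral_measurable_subprob_algebra[OF unit_funD(1)[OF f]]])
qed (auto intro: integral_unit_fun_bounds[OF kernel_at f])

lemma unit_fun_taboo: "C \<in> sets borel \<Longrightarrow> unit_fun f \<Longrightarrow> unit_fun (taboo C f)"
  unfolding taboo_def[abs_def]
  by (intro unit_fun_integral unit_fun_mult unit_fun_indicator)

lemma unit_fun_taboo_pow: "C \<in> sets borel \<Longrightarrow> unit_fun f \<Longrightarrow> unit_fun ((taboo C ^^ n) f)"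
  by (induction n) (auto intro: unit_fun_taboo)

lemma taboo_UNIV: "taboo UNIV f x = (\<integral>z. f z \<partial>K x)"
  by (simp add: taboo_def)

end

locale markov_chain = halfline_kernel +
  fixes P :: "real measure \<Rightarrow> 'w measure" and X :: "nat \<Rightarrow> 'w \<Rightarrow> real"
  assumes markov: "\<And>G. G \<in> space (prob_algebra halfline) \<Longrightarrow> markov_law K G (P G) X"
begin

section \<open>From path probabilities to iterated kernel operators\<close>

context
  fixes G assumes G: "G \<in> space (prob_algebra halfline)"
begin

lemma prob_space_P: "prob_space (P G)"
  using markov[OF G] by (simp add: markov_law_def)

lemma X_measurable: "X n \<in> P G \<rightarrow>\<^sub>M halfline"
  using markov[OF G] by (simp add: markov_law_def)

lemma X_borel [measurable]: "X n \<in> borel_measurable (P G)"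
  using measurable_comp[OF X_measurable borel_measurable_halfline[of "\<lambda>x. x"]] by (simp add: comp_def)

lemma X_nonneg: "\<omega> \<in> space (P G) \<Longrightarrow> 0 \<le> X n \<omega>"
  using measurable_space[OF X_measurable] by simp

lemma distr_X_0: "distr (P G) halfline (X 0) = G"
  using markov[OF G] by (simp add: markov_law_def)

lemma space_natural_filtration: "space (natural_filtration (P G) X n) = space (P G)"
  by (simp add: natural_filtration_def)

lemma sets_natural_filtration: "sets (natural_filtration (P G) X n) \<subseteq> sets (P G)"
  unfolding natural_filtration_def
  by (intro sets_image_in_sets measurable_restrict X_measurable refl)

lemma X_natural_filtration: "i \<le> n \<Longrightarrow> X i \<in> borel_measurable (natural_filtration (P G) X n)"
proof -
  assume i: "i \<le> n"
  let ?N = "natural_filtration (P G) X n"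
  have "(\<lambda>\<omega>. \<lambda>i\<in>{..n}. X i \<omega>) \<in> ?N \<rightarrow>\<^sub>M Pi\<^sub>M {..n} (\<lambda>_. halfline)"
    unfolding natural_filtration_def
    by (intro measurable_vimage_algebra1) (auto simp: space_PiM X_nonneg)
  from measurable_compose[OF measurable_compose[OF this measurable_component_singleton[of i]]
      borel_measurable_halfline[of "\<lambda>x. x"]]
  show ?thesis using i by simp
qed

lemma integral_initial: "unit_fun f \<Longrightarrow> (\<integral>\<omega>. f (X 0 \<omega>) \<partial>P G) = (\<integral>z. f z \<partial>G)"
  using integral_distr[OF X_measurable, of f 0] unit_funD(1)[of f] by (simp add: distr_X_0)

text \<open>The Markov hypothesis concerns indicators of sets. Restricting \<open>P G\<close> to
  \<open>E\<close> turns it into the equality of two measures, the law of \<open>X (Suc n)\<close>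
  and the mixture of the kernels \<open>K (X n \<omega>)\<close>, and equal measures integrate every
  \<open>f\<close> equally.\<close>

lemma one_step:
  assumes E: "E \<in> sets (natural_filtration (P G) X n)" and f: "unit_fun f"
  shows "(\<integral>\<omega>. indicator E \<omega> * f (X (Suc n) \<omega>) \<partial>P G)
       = (\<integral>\<omega>. indicator E \<omega> * (\<integral>z. f z \<partial>K (X n \<omega>)) \<partial>P G)"
proof -
  interpret prob_space "P G" by (rule prob_space_P)
  let ?F = "natural_filtration (P G) X n"
  have "finite_measure_subalgebra (P G) ?F"
    by unfold_locales (auto simp: subalgebra_def space_natural_filtration intro: sets_natural_filtration[THEN subsetD])
  then interpret sigma_finite_subalgebra "P G" ?F
    by (rule finite_measure_subalgebra_is_sigma_finite)
  have EM [measurable]: "E \<in> sets (P G)" using E sets_natural_filtration by auto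
  note [measurable] = X_measurable
  have KX [measurable]: "(\<lambda>\<omega>. K (X n \<omega>)) \<in> P G \<rightarrow>\<^sub>M subprob_algebra halfline"
    by (rule measurable_compose[OF X_measurable K_measurable'])
  define D where "D = density (P G) (indicator E)"
  define N1 where "N1 = distr D halfline (X (Suc n))"
  define N2 where "N2 = bind D (\<lambda>\<omega>. K (X n \<omega>))"
  have sD [measurable_cong, simp]: "sets D = sets (P G)" and spD: "space D = space (P G)" by (simp_all add: D_def)
  have ne: "space D \<noteq> {}" using not_empty by (simp add: spD)
  have KX': "(\<lambda>\<omega>. K (X n \<omega>)) \<in> D \<rightarrow>\<^sub>M subprob_algebra halfline"
    using KX by (simp cong: measurable_cong_sets)
  have setsK: "sets (K (X n \<omega>)) = sets halfline" if "\<omega> \<in> space (P G)" for \<omega>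
    using in_prob_algebra_halfline(2)[OF kernel_at[OF X_nonneg[OF that]]] .
  have "N1 = N2"
  proof (rule measure_eqI)
    show "sets N1 = sets N2"
      unfolding N1_def N2_def using ne setsK by (subst sets_bind[where N=halfline]) (auto simp: spD)
  next
    fix B assume "B \<in> sets N1"
    then have B [measurable]: "B \<in> sets halfline" by (simp add: N1_def)
    have bB: "B \<in> sets borel" using B by (simp add: sets_halfline)
    have mK: "(\<lambda>\<omega>. measure (K (X n \<omega>)) B) \<in> borel_measurable (P G)"
      using measurable_compose[OF KX measurable_measure_subprob_algebra[OF B]] .
    have K1: "measure (K (X n \<omega>)) B \<le> 1" if "\<omega> \<in> space (P G)" for \<omega>
      using prob_space.prob_le_1[OF in_prob_algebra_halfline(1)[OF kernel_at[OF X_nonneg[OF that]]]] .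
    have "emeasure N1 B = (\<integral>\<^sup>+\<omega>. indicator E \<omega> * indicator B (X (Suc n) \<omega>) \<partial>P G)"
    proof -
      have "emeasure N1 B = (\<integral>\<^sup>+z. indicator B z \<partial>N1)" by (simp add: N1_def)
      also have "\<dots> = (\<integral>\<^sup>+\<omega>. indicator B (X (Suc n) \<omega>) \<partial>D)"
        unfolding N1_def by (intro nn_integral_distr) auto
      also have "\<dots> = (\<integral>\<^sup>+\<omega>. indicator E \<omega> * indicator B (X (Suc n) \<omega>) \<partial>P G)"
        unfolding D_def by (intro nn_integral_density) auto
      finally show ?thesis .
    qed
    also have "\<dots> = (\<integral>\<^sup>+\<omega>. ennreal (indicator E \<omega> * indicator B (X (Suc n) \<omega>)) \<partial>P G)"
      by (intro nn_integral_cong) (simp split: split_indicator)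
    also have "\<dots> = ennreal (\<integral>\<omega>. indicator E \<omega> * indicator B (X (Suc n) \<omega>) \<partial>P G)"
      by (intro nn_integral_eq_integral integrable_const_bound[where B=1]) (auto split: split_indicator)
    \<comment> \<open>The conditional expectation may be inserted because \<open>E\<close> belongs
      to the natural filtration at time \<open>n\<close>.\<close>
    also have "(\<integral>\<omega>. indicator E \<omega> * indicator B (X (Suc n) \<omega>) \<partial>P G)
        = (\<integral>\<omega>. indicator E \<omega> * real_cond_exp (P G) ?F (\<lambda>\<omega>. indicator B (X (Suc n) \<omega>)) \<omega> \<partial>P G)"
      using E by (intro real_cond_exp_intg(2)[symmetric] integrable_const_bound[where B=1])
        (auto split: split_indicator)
    also have "\<dots> = (\<integral>\<omega>. indicator E \<omega> * measure (K (X n \<omega>)) B \<partial>P G)"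
    proof (rule integral_cong_AE)
      have "AE \<omega> in P G. real_cond_exp (P G) ?F (\<lambda>\<omega>. indicator B (X (Suc n) \<omega>)) \<omega> = measure (K (X n \<omega>)) B"
        using markov[OF G] B unfolding markov_law_def by blast
      then show "AE \<omega> in P G. indicator E \<omega> * real_cond_exp (P G) ?F (\<lambda>\<omega>. indicator B (X (Suc n) \<omega>)) \<omega>
          = indicator E \<omega> * measure (K (X n \<omega>)) B"
        by eventually_elim simp
    qed (use mK in measurable)
    also have "ennreal \<dots> = (\<integral>\<^sup>+\<omega>. ennreal (indicator E \<omega> * measure (K (X n \<omega>)) B) \<partial>P G)"
      using mK K1 by (intro nn_integral_eq_integral[symmetric] integrable_const_bound[where B=1])
        (auto split: split_indicator)
    also have "\<dots> = (\<integral>\<^sup>+\<omega>. indicator E \<omega> * emeasure (K (X n \<omega>)) B \<partial>P G)"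
    proof (intro nn_integral_cong)
      fix \<omega> assume "\<omega> \<in> space (P G)"
      then interpret k: prob_space "K (X n \<omega>)" by (intro in_prob_algebra_halfline kernel_at X_nonneg)
      show "ennreal (indicator E \<omega> * measure (K (X n \<omega>)) B) = indicator E \<omega> * emeasure (K (X n \<omega>)) B"
        by (simp add: k.emeasure_eq_measure split: split_indicator)
    qed
    also have "\<dots> = (\<integral>\<^sup>+\<omega>. emeasure (K (X n \<omega>)) B \<partial>D)"
      unfolding D_def using measurable_compose[OF KX measurable_emeasure_subprob_algebra[OF B]]
      by (intro nn_integral_density[symmetric]) auto
    also have "\<dots> = emeasure N2 B"
      unfolding N2_def by (rule emeasure_bind[OF ne KX' B, symmetric])
    finally show "emeasure N1 B = emeasure N2 B" .
  qed
  let ?f = "\<lambda>z. ennreal (f z)"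
  have fm [measurable]: "f \<in> borel_measurable halfline" by (rule unit_funD[OF f])
  have fb: "0 \<le> f (X k \<omega>)" "f (X k \<omega>) \<le> 1" if "\<omega> \<in> space (P G)" for k \<omega>
    using unit_funD[OF f] X_nonneg[OF that] by auto
  have Kfb: "0 \<le> (\<integral>z. f z \<partial>K (X n \<omega>))" "(\<integral>z. f z \<partial>K (X n \<omega>)) \<le> 1" if "\<omega> \<in> space (P G)" for \<omega>
    using integral_unit_fun_bounds[OF kernel_at[OF X_nonneg[OF that]] f] by auto
  have Kfm: "(\<lambda>\<omega>. \<integral>z. f z \<partial>K (X n \<omega>)) \<in> borel_measurable (P G)"
    using measurable_compose[OF KX integral_measurable_subprob_algebra[OF fm]] .
  have "ennreal (\<integral>\<omega>. indicator E \<omega> * f (X (Suc n) \<omega>) \<partial>P G)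
      = (\<integral>\<^sup>+\<omega>. ennreal (indicator E \<omega> * f (X (Suc n) \<omega>)) \<partial>P G)"
    using fb by (intro nn_integral_eq_integral[symmetric] integrable_const_bound[where B=1])
        (auto split: split_indicator)
  also have "\<dots> = (\<integral>\<^sup>+\<omega>. indicator E \<omega> * ?f (X (Suc n) \<omega>) \<partial>P G)"
    by (intro nn_integral_cong) (simp split: split_indicator)
  also have "\<dots> = (\<integral>\<^sup>+\<omega>. ?f (X (Suc n) \<omega>) \<partial>D)"
    unfolding D_def by (intro nn_integral_density[symmetric]) auto
  also have "\<dots> = (\<integral>\<^sup>+z. ?f z \<partial>N1)"
    unfolding N1_def by (intro nn_integral_distr[symmetric]) auto
  also have "\<dots> = (\<integral>\<^sup>+\<omega>. \<integral>\<^sup>+z. ?f z \<partial>K (X n \<omega>) \<partial>D)"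
    unfolding \<open>N1 = N2\<close> N2_def by (intro nn_integral_bind[OF _ KX']) simp
  also have "\<dots> = (\<integral>\<^sup>+\<omega>. indicator E \<omega> * (\<integral>\<^sup>+z. ?f z \<partial>K (X n \<omega>)) \<partial>P G)"
    unfolding D_def using measurable_compose[OF KX nn_integral_measurable_subprob_algebra[of ?f]]
    by (intro nn_integral_density) auto
  also have "\<dots> = (\<integral>\<^sup>+\<omega>. ennreal (indicator E \<omega> * (\<integral>z. f z \<partial>K (X n \<omega>))) \<partial>P G)"
  proof (intro nn_integral_cong)
    fix \<omega> assume w: "\<omega> \<in> space (P G)"
    note k = kernel_at[OF X_nonneg[OF w, of n]]
    have "(\<integral>\<^sup>+z. ?f z \<partial>K (X n \<omega>)) = ennreal (\<integral>z. f z \<partial>K (X n \<omega>))"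
      using integrable_unit_fun[OF k f] unit_funD(2)[OF f] in_prob_algebra_halfline(3)[OF k]
      by (intro nn_integral_eq_integral) auto
    then show "indicator E \<omega> * (\<integral>\<^sup>+z. ?f z \<partial>K (X n \<omega>)) = ennreal (indicator E \<omega> * (\<integral>z. f z \<partial>K (X n \<omega>)))"
      by (simp split: split_indicator)
  qed
  also have "\<dots> = ennreal (\<integral>\<omega>. indicator E \<omega> * (\<integral>z. f z \<partial>K (X n \<omega>)) \<partial>P G)"
    using Kfb Kfm by (intro nn_integral_eq_integral integrable_const_bound[where B=1])
        (auto split: split_indicator)
  finally show ?thesis
    using fb Kfb by (subst (asm) ennreal_inj) (auto intro!: Bochner_Integration.integral_nonneg_AE AE_I2 split: split_indicator)
qed

text \<open>The last step is the one the Markov property can integrate out: it replaces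
  \<open>f\<close> by \<open>taboo C f\<close> and leaves an event up to time \<open>n\<close>. The
  induction therefore runs over all \<open>f\<close> at once.\<close>

lemma taboo_law:
  assumes C [measurable]: "C \<in> sets borel" and f: "unit_fun f"
  shows "(\<integral>\<omega>. indicator {\<omega> \<in> space (P G). \<forall>i\<in>{1..n}. X i \<omega> \<in> C} \<omega> * f (X n \<omega>) \<partial>P G)
       = (\<integral>z. (taboo C ^^ n) f z \<partial>G)"
  using f
proof (induction n arbitrary: f)
  case 0
  have "(\<integral>\<omega>. indicator {\<omega> \<in> space (P G). \<forall>i\<in>{1..0}. X i \<omega> \<in> C} \<omega> * f (X 0 \<omega>) \<partial>P G)
      = (\<integral>\<omega>. f (X 0 \<omega>) \<partial>P G)"
    by (intro Bochner_Integration.integral_cong) auto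
  then show ?case using integral_initial[OF 0] by simp
next
  case (Suc n)
  let ?E = "\<lambda>n. {\<omega> \<in> space (P G). \<forall>i\<in>{1..n}. X i \<omega> \<in> C}"
  have [measurable]: "X i \<in> borel_measurable (natural_filtration (P G) X n)" if "i \<in> {1..n}" for i
    using X_natural_filtration that by simp
  have E: "?E n \<in> sets (natural_filtration (P G) X n)"
    unfolding space_natural_filtration[of n, symmetric] by measurable
  have "(\<integral>\<omega>. indicator (?E (Suc n)) \<omega> * f (X (Suc n) \<omega>) \<partial>P G)
      = (\<integral>\<omega>. indicator (?E n) \<omega> * (indicator C (X (Suc n) \<omega>) * f (X (Suc n) \<omega>)) \<partial>P G)"
    by (intro Bochner_Integration.integral_cong) (auto simp: atLeastAtMostSuc_conv split: split_indicator)
  also have "\<dots> = (\<integral>\<omega>. indicator (?E n) \<omega> * taboo C f (X n \<omega>) \<partial>P G)"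
    unfolding taboo_def
    by (intro one_step[OF E, of "\<lambda>z. indicator C z * f z"] unit_fun_mult unit_fun_indicator C Suc.prems)
  also have "\<dots> = (\<integral>z. (taboo C ^^ n) (taboo C f) z \<partial>G)"
    by (intro Suc.IH unit_fun_taboo C Suc.prems)
  finally show ?case by (simp add: funpow_swap1)
qed

lemma prob_taboo:
  assumes C [measurable]: "C \<in> sets borel" and B [measurable]: "B \<in> sets borel"
  shows "\<P>(\<omega> in P G. X n \<omega> \<in> B \<and> (\<forall>i\<in>{1..n}. X i \<omega> \<in> C)) = (\<integral>z. (taboo C ^^ n) (indicator B) z \<partial>G)"
proof -
  have "(\<integral>z. (taboo C ^^ n) (indicator B) z \<partial>G)
     = (\<integral>\<omega>. indicator {\<omega> \<in> space (P G). \<forall>i\<in>{1..n}. X i \<omega> \<in> C} \<omega> * indicator B (X n \<omega>) \<partial>P G)"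
    using taboo_law[OF C unit_fun_indicator[OF B], of n] by simp
  also have "\<dots> = (\<integral>\<omega>. indicator {\<omega> \<in> space (P G). X n \<omega> \<in> B \<and> (\<forall>i\<in>{1..n}. X i \<omega> \<in> C)} \<omega> \<partial>P G)"
    by (intro Bochner_Integration.integral_cong) (auto split: split_indicator)
  also have "\<dots> = \<P>(\<omega> in P G. X n \<omega> \<in> B \<and> (\<forall>i\<in>{1..n}. X i \<omega> \<in> C))"
    by (subst Bochner_Integration.integral_indicator) (auto intro!: arg_cong[where f="measure (P G)"])
  finally show ?thesis by simp
qed

lemma prob_exit:
  assumes B: "B \<in> sets borel"
  shows "\<P>(\<omega> in P G. X n \<omega> \<in> B \<and> exit_time X A \<omega> > enat n) = (\<integral>z. (taboo {..A} ^^ n) (indicator B) z \<partial>G)"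
  using prob_taboo[OF _ B, of "{..A}" n] by (simp add: exit_time_gt_iff)

lemma prob_marginal:
  assumes B: "B \<in> sets borel"
  shows "\<P>(\<omega> in P G. X n \<omega> \<in> B) = (\<integral>z. (taboo UNIV ^^ n) (indicator B) z \<partial>G)"
  using prob_taboo[OF _ B, of "UNIV" n] by simp

end

end

section \<open>Survival probabilities and the independent coupling\<close>

text \<open>The order is phrased with lower intervals because integrals of decreasing functions are
  compared through down-sets.\<close>

locale monotone_kernel = halfline_kernel +
  assumes K_mono: "\<And>x x' y. 0 \<le> x \<Longrightarrow> x \<le> x' \<Longrightarrow> measure (K x') {0..y} \<le> measure (K x) {0..y}"
begin

lemma antimono_integral:
  assumes "unit_fun f" and "antimono_on {0..} f"
  shows "antimono_on {0..} (\<lambda>x. \<integral>z. f z \<partial>K x)"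
  using integral_le_of_stoch_le[OF kernel_at kernel_at K_mono assms] by (intro monotone_onI) auto

lemma antimono_taboo_UNIV_pow:
  assumes f: "unit_fun f" and anti: "antimono_on {0..} f"
  shows "antimono_on {0..} ((taboo UNIV ^^ n) f)"
proof (induction n)
  case (Suc n)
  then show ?case
    using antimono_integral[OF unit_fun_taboo_pow[OF _ f] Suc] by (simp add: taboo_def[abs_def])
qed (use anti in simp)

abbreviation surv :: "real \<Rightarrow> nat \<Rightarrow> real \<Rightarrow> real" where
  "surv A n \<equiv> (taboo {..A} ^^ n) (\<lambda>_. 1)"

lemma unit_fun_surv: "unit_fun (surv A n)"
  by (intro unit_fun_taboo_pow unit_fun_const) auto

lemma surv_Suc: "surv A (Suc n) x = (\<integral>z. indicator {..A} z * surv A n z \<partial>K x)"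
  by (simp add: taboo_def)

lemma unit_fun_killed: "unit_fun (\<lambda>z. indicator {..A} z * surv A n z)"
  by (intro unit_fun_mult unit_fun_indicator unit_fun_surv) simp

text \<open>Killing acts only above \<open>A\<close> and puts the value 0 there, which a nonnegative
  function cannot undercut.\<close>

lemma antimono_killed:
  assumes "antimono_on {0..} (surv A n)"
  shows "antimono_on {0..} (\<lambda>z. indicator {..A} z * surv A n z)"
  using monotone_onD[OF assms] unit_funD(2)[OF unit_fun_surv]
  by (intro monotone_onI) (auto split: split_indicator)

lemma antimono_surv: "antimono_on {0..} (surv A n)"
proof (induction n)
  case 0
  show ?case by (simp add: monotone_on_def)
next
  case (Suc n)
  show ?case
    using antimono_integral[OF unit_fun_killed antimono_killed[OF Suc]]
    by (simp only: surv_Suc[abs_def])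
qed

lemma surv_le_surv_0: "0 \<le> x \<Longrightarrow> surv A n x \<le> surv A n 0"
  using monotone_onD[OF antimono_surv, of 0 x] by simp

text \<open>A path that survives \<open>n\<close> steps restarts from some state, and no state
  survives a further \<open>m\<close> steps more easily than 0.\<close>

lemma surv_add_le: "0 \<le> x \<Longrightarrow> surv A (n + m) x \<le> surv A n x * surv A m 0"
proof (induction n arbitrary: x)
  case 0
  then show ?case using surv_le_surv_0 by simp
next
  case (Suc n)
  note k = kernel_at[OF Suc.prems]
  have c: "unit_fun (\<lambda>z. surv A m 0)"
    using unit_funD[OF unit_fun_surv, of 0] by (intro unit_fun_const) auto
  have "surv A (Suc (n + m)) x \<le> (\<integral>z. (indicator {..A} z * surv A n z) * surv A m 0 \<partial>K x)"
    unfolding surv_Suc using Suc.IH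
    by (intro integral_unit_fun_mono[OF k] unit_fun_killed unit_fun_mult[OF unit_fun_killed c])
       (auto split: split_indicator)
  also have "\<dots> = surv A (Suc n) x * surv A m 0"
    unfolding surv_Suc by simp
  finally show ?case by simp
qed

text \<open>Divided by \<open>surv A n x\<close>, this says that conditioning on survival raises the
  expectation of a decreasing function. Association is used only for the law \<open>K x\<close> of a
  single step: the killed survival function and the free \<open>n\<close>-step expectation of
  \<open>f\<close> are both decreasing, so Chebyshev's inequality applies and the induction does the
  rest.\<close>

lemma taboo_pow_ge_product:
  assumes f: "unit_fun f" and anti: "antimono_on {0..} f" and x: "0 \<le> x"
  shows "(taboo UNIV ^^ n) f x * surv A n x \<le> (taboo {..A} ^^ n) f x"
  using x
proof (induction n arbitrary: x)
  case (Suc n)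
  let ?g = "(taboo UNIV ^^ n) f"
  note k = kernel_at[OF Suc.prems]
  have g: "unit_fun ?g" by (intro unit_fun_taboo_pow f) simp
  have h: "unit_fun ((taboo {..A} ^^ n) f)" by (intro unit_fun_taboo_pow f) simp
  have "(taboo UNIV ^^ Suc n) f x * surv A (Suc n) x
      = (\<integral>z. indicator {..A} z * surv A n z \<partial>K x) * (\<integral>z. ?g z \<partial>K x)"
    by (simp add: taboo_def)
  also have "\<dots> \<le> (\<integral>z. (indicator {..A} z * surv A n z) * ?g z \<partial>K x)"
    by (intro chebyshev_association[OF k] unit_fun_killed antimono_killed antimono_surv g
        antimono_taboo_UNIV_pow f anti)
  also have "\<dots> \<le> (\<integral>z. indicator {..A} z * (taboo {..A} ^^ n) f z \<partial>K x)"
    using Suc.IH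
    by (intro integral_unit_fun_mono[OF k] unit_fun_mult unit_fun_indicator unit_fun_surv g h)
       (auto simp: mult.commute split: split_indicator)
  also have "\<dots> = (taboo {..A} ^^ Suc n) f x"
    by (simp add: taboo_def)
  finally show ?case .
qed simp

text \<open>For a fixed horizon the barrier recedes beyond reach, by dominated convergence one step
  at a time. No uniformity in \<open>n\<close> is claimed, so the coupling horizon has to be fixed
  before \<open>A\<close>.\<close>

lemma surv_tendsto_1: "0 \<le> x \<Longrightarrow> ((\<lambda>A. surv A n x) \<longlongrightarrow> 1) at_top"
proof (induction n arbitrary: x)
  case (Suc n)
  note k = kernel_at[OF Suc.prems]
  note H = in_prob_algebra_halfline[OF k]
  interpret prob_space "K x" by (rule H)
  have meas: "(\<lambda>z. indicator {..A} z * surv A n z) \<in> borel_measurable (K x)" for A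
    using integrable_unit_fun[OF k unit_fun_killed] by auto
  have lim: "((\<lambda>A. indicator {..A} z * surv A n z) \<longlongrightarrow> 1) at_top" if "0 \<le> z" for z
  proof (rule Lim_transform_eventually[OF Suc.IH[OF that]])
    show "\<forall>\<^sub>F A in at_top. surv A n z = indicator {..A} z * surv A n z"
      using eventually_ge_at_top[of z] by eventually_elim simp
  qed
  have "((\<lambda>A. \<integral>z. indicator {..A} z * surv A n z \<partial>K x) \<longlongrightarrow> (\<integral>z. 1 \<partial>K x)) at_top"
  proof (rule integral_dominated_convergence_at_top[where w="\<lambda>_. 1"])
    have "norm (indicator {..A} z * surv A n z) \<le> 1" if "0 \<le> z" for A z
      using unit_funD(2,3)[OF unit_fun_killed[of A n] that] by simp
    then show "\<forall>\<^sub>F A in at_top. AE z in K x. norm (indicator {..A} z * surv A n z) \<le> 1"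
      by (intro always_eventually allI AE_I2) (simp only: H(3) atLeast_iff)
  qed (use meas lim in \<open>auto simp: H(3)\<close>)
  then show ?case unfolding surv_Suc by (simp add: prob_space)
qed simp

end

section \<open>Functions of two states and the independent coupling\<close>

definition unit_fun2 :: "(real \<times> real \<Rightarrow> real) \<Rightarrow> bool" where
  "unit_fun2 f \<longleftrightarrow> f \<in> borel_measurable (halfline \<Otimes>\<^sub>M halfline) \<and>
     (\<forall>y\<ge>0. \<forall>x\<ge>0. 0 \<le> f (y, x) \<and> f (y, x) \<le> 1)"

lemma unit_fun2D:
  assumes "unit_fun2 f"
  shows "f \<in> borel_measurable (halfline \<Otimes>\<^sub>M halfline)"
    "0 \<le> y \<Longrightarrow> 0 \<le> x \<Longrightarrow> 0 \<le> f (y, x)" "0 \<le> y \<Longrightarrow> 0 \<le> x \<Longrightarrow> f (y, x) \<le> 1"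
  using assms by (auto simp: unit_fun2_def)

lemma unit_fun2_fst: "unit_fun f \<Longrightarrow> unit_fun2 (\<lambda>z. f (fst z))"
  unfolding unit_fun2_def using unit_funD[of f] by (auto intro: measurable_compose[OF measurable_fst])

lemma unit_fun2_snd: "unit_fun f \<Longrightarrow> unit_fun2 (\<lambda>z. f (snd z))"
  unfolding unit_fun2_def using unit_funD[of f] by (auto intro: measurable_compose[OF measurable_snd])

context halfline_kernel
begin

text \<open>The coupling: two copies of the chain started from \<open>y\<close> and \<open>x\<close> move independently until the
  first copy catches up with the second. \<open>no_meeting m (y, x)\<close> is the probability that
  this has not happened at any of the times \<open>1, \<dots>, m\<close>.\<close>

definition pair_kernel :: "real \<times> real \<Rightarrow> (real \<times> real) measure" where
  "pair_kernel w = K (fst w) \<Otimes>\<^sub>M K (snd w)"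

text \<open>Reaching equality and jumping past both end the separation: survival is decreasing in
  the state, so the order of the copies is enough and they need not coalesce. The order is tested on
  arrival only; the initial pair may be in any order.\<close>

definition separated :: "(real \<times> real \<Rightarrow> real) \<Rightarrow> real \<times> real \<Rightarrow> real" where
  "separated f w = (\<integral>z. (if fst z < snd z then f z else 0) \<partial>pair_kernel w)"

definition no_meeting :: "nat \<Rightarrow> real \<times> real \<Rightarrow> real" where
  "no_meeting m = (separated ^^ m) (\<lambda>_. 1)"

lemma no_meeting_Suc: "no_meeting (Suc m) = separated (no_meeting m)"
  by (simp add: no_meeting_def)

lemma pair_kernel_measurable: "pair_kernel \<in> halfline \<Otimes>\<^sub>M halfline \<rightarrow>\<^sub>M prob_algebra (halfline \<Otimes>\<^sub>M halfline)"
  unfolding pair_kernel_def[abs_def]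
  by (intro measurable_pair_prob measurable_compose[OF measurable_fst K_measurable]
      measurable_compose[OF measurable_snd K_measurable])

context
  fixes y x :: real assumes yx: "0 \<le> y" "0 \<le> x"
begin

lemma pair_kernel_at:
  shows "prob_space (pair_kernel (y, x))" "sets (pair_kernel (y, x)) = sets (halfline \<Otimes>\<^sub>M halfline)"
    "space (pair_kernel (y, x)) = {0..} \<times> {0..}"
proof -
  have "pair_kernel (y, x) \<in> space (prob_algebra (halfline \<Otimes>\<^sub>M halfline))"
    using measurable_space[OF pair_kernel_measurable, of "(y, x)"] yx by (simp add: space_pair_measure)
  then show "prob_space (pair_kernel (y, x))"
    and s: "sets (pair_kernel (y, x)) = sets (halfline \<Otimes>\<^sub>M halfline)"
    by (auto simp: space_prob_algebra)
  show "space (pair_kernel (y, x)) = {0..} \<times> {0..}"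
    using sets_eq_imp_space_eq[OF s] by (simp add: space_pair_measure)
qed

lemma integrable_unit_fun2:
  assumes f: "unit_fun2 f"
  shows "integrable (pair_kernel (y, x)) f"
proof -
  interpret prob_space "pair_kernel (y, x)" by (rule pair_kernel_at)
  have "f \<in> borel_measurable (pair_kernel (y, x))"
    using unit_fun2D(1)[OF f] pair_kernel_at(2) by (simp cong: measurable_cong_sets)
  then show ?thesis
    using pair_kernel_at(3) unit_fun2D(2,3)[OF f]
    by (intro integrable_const_bound[where B=1]) auto
qed

lemma integral_pair_kernel_product:
  assumes f: "unit_fun f" and g: "unit_fun g"
  shows "(\<integral>z. f (fst z) * g (snd z) \<partial>pair_kernel (y, x)) = (\<integral>z. f z \<partial>K y) * (\<integral>z. g z \<partial>K x)"
    and "integrable (pair_kernel (y, x)) (\<lambda>z. f (fst z) * g (snd z))"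
proof -
  interpret ky: prob_space "K y" using in_prob_algebra_halfline(1)[OF kernel_at[OF yx(1)]] .
  interpret kx: prob_space "K x" using in_prob_algebra_halfline(1)[OF kernel_at[OF yx(2)]] .
  interpret pair_sigma_finite "K y" "K x" ..
  interpret prob_space "pair_kernel (y, x)" by (rule pair_kernel_at)
  have "(\<lambda>z. f (fst z)) \<in> borel_measurable (pair_kernel (y, x))"
       "(\<lambda>z. g (snd z)) \<in> borel_measurable (pair_kernel (y, x))"
    using integrable_unit_fun2[OF unit_fun2_fst[OF f]] integrable_unit_fun2[OF unit_fun2_snd[OF g]] by auto
  then show int: "integrable (pair_kernel (y, x)) (\<lambda>z. f (fst z) * g (snd z))"
    using unit_funD(2,3)[OF f] unit_funD(2,3)[OF g] pair_kernel_at(3)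
    by (intro integrable_const_bound[where B=1] borel_measurable_times) (auto simp: abs_mult mult_le_one)
  show "(\<integral>z. f (fst z) * g (snd z) \<partial>pair_kernel (y, x)) = (\<integral>z. f z \<partial>K y) * (\<integral>z. g z \<partial>K x)"
    using integral_fst'[of "\<lambda>z. f (fst z) * g (snd z)"] int by (simp add: pair_kernel_def)
qed

lemma integral_pair_kernel_fst: "unit_fun f \<Longrightarrow> (\<integral>z. f (fst z) \<partial>pair_kernel (y, x)) = (\<integral>z. f z \<partial>K y)"
  using integral_pair_kernel_product(1)[of f "\<lambda>_. 1"] unit_fun_const[of 1]
    prob_space.prob_space[OF in_prob_algebra_halfline(1)[OF kernel_at[OF yx(2)]]] by simp

lemma integral_pair_kernel_snd: "unit_fun f \<Longrightarrow> (\<integral>z. f (snd z) \<partial>pair_kernel (y, x)) = (\<integral>z. f z \<partial>K x)"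
  using integral_pair_kernel_product(1)[of "\<lambda>_. 1" f] unit_fun_const[of 1]
    prob_space.prob_space[OF in_prob_algebra_halfline(1)[OF kernel_at[OF yx(1)]]] by simp

end

lemma unit_fun2_restrict:
  assumes f: "unit_fun2 f"
  shows "unit_fun2 (\<lambda>z. if fst z < snd z then f z else 0)"
proof -
  have m: "fst \<in> borel_measurable (halfline \<Otimes>\<^sub>M halfline)" "snd \<in> borel_measurable (halfline \<Otimes>\<^sub>M halfline)"
    using measurable_compose[OF measurable_fst borel_measurable_halfline[of "\<lambda>x. x"], of halfline]
      measurable_compose[OF measurable_snd borel_measurable_halfline[of "\<lambda>x. x"], of halfline]
    by simp_all
  note [measurable] = m unit_fun2D(1)[OF f]
  have "(\<lambda>z. if fst z < snd z then f z else 0) \<in> borel_measurable (halfline \<Otimes>\<^sub>M halfline)" by measurable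
  then show ?thesis using unit_fun2D(2,3)[OF f] by (auto simp: unit_fun2_def)
qed

lemma separated_mono:
  assumes f: "unit_fun2 f" and g: "unit_fun2 g" and yx: "0 \<le> y" "0 \<le> x"
    and le: "\<And>y x. 0 \<le> y \<Longrightarrow> 0 \<le> x \<Longrightarrow> f (y, x) \<le> g (y, x)"
  shows "separated f (y, x) \<le> separated g (y, x)"
  unfolding separated_def using le pair_kernel_at(3)[OF yx]
  by (intro integral_mono integrable_unit_fun2 unit_fun2_restrict f g yx) auto

lemma unit_fun2_separated:
  assumes f: "unit_fun2 f"
  shows "unit_fun2 (separated f)"
  unfolding unit_fun2_def
proof (intro conjI allI impI)
  note r = unit_fun2_restrict[OF f]
  show "separated f \<in> borel_measurable (halfline \<Otimes>\<^sub>M halfline)"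
    unfolding separated_def[abs_def]
    using measurable_compose[OF measurable_prob_algebraD[OF pair_kernel_measurable]
      integral_measurable_subprob_algebra[OF unit_fun2D(1)[OF r]]] .
  fix y x :: real assume yx: "0 \<le> y" "0 \<le> x"
  interpret prob_space "pair_kernel (y, x)" by (rule pair_kernel_at[OF yx])
  show "0 \<le> separated f (y, x)"
    unfolding separated_def using unit_fun2D(2)[OF f] pair_kernel_at(3)[OF yx]
    by (intro Bochner_Integration.integral_nonneg) auto
  have "separated f (y, x) \<le> (\<integral>z. 1 \<partial>pair_kernel (y, x))"
    unfolding separated_def using unit_fun2D(3)[OF f] pair_kernel_at(3)[OF yx]
    by (intro integral_mono integrable_unit_fun2 r yx) (auto simp: unit_fun2_def)
  then show "separated f (y, x) \<le> 1" by (simp only: lebesgue_integral_const prob_space) simp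
qed

lemma unit_fun2_no_meeting: "unit_fun2 (no_meeting m)"
  by (induction m) (auto simp: no_meeting_Suc intro: unit_fun2_separated, simp add: no_meeting_def unit_fun2_def)

lemma no_meeting_decreasing: "0 \<le> y \<Longrightarrow> 0 \<le> x \<Longrightarrow> no_meeting (Suc m) (y, x) \<le> no_meeting m (y, x)"
proof (induction m arbitrary: y x)
  case 0
  then show ?case using unit_fun2D(3)[OF unit_fun2_no_meeting[of "Suc 0"]] by (simp add: no_meeting_def)
next
  case (Suc m)
  then show ?case
    unfolding no_meeting_Suc[of "Suc m"] no_meeting_Suc[of m]
    by (intro separated_mono) (auto simp flip: no_meeting_Suc intro: unit_fun2_no_meeting)
qed

text \<open>If at time \<open>m\<close> the first copy is above \<open>a\<close> and the second is
  not, they have crossed; by independence this has probability \<open>(1 - k m y) * k m x\<close>.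
  The guard \<open>y < x\<close> matches the condition inside \<open>separated\<close>, which lets
  the induction pass through it.\<close>

lemma no_meeting_le:
  fixes a :: real
  defines "k \<equiv> \<lambda>m. (taboo UNIV ^^ m) (indicator {..a})"
  assumes yx: "0 \<le> y" "0 \<le> x"
  shows "(if y < x then no_meeting m (y, x) else 0) \<le> 1 - (1 - k m y) * k m x"
  using yx
proof (induction m arbitrary: y x)
  case 0
  \<comment> \<open>At time 0 the product vanishes, since \<open>a < y\<close> and
    \<open>x \<le> a\<close> contradict \<open>y < x\<close>.\<close>
  then show ?case by (auto simp: no_meeting_def k_def split: split_indicator)
next
  case (Suc m)
  have u: "unit_fun (k m)" for m
    unfolding k_def by (intro unit_fun_taboo_pow unit_fun_indicator) simp_all
  note u' = unit_fun_diff[OF u]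
  show ?case
  proof (cases "y < x")
    case False
    then show ?thesis
      using unit_funD(2,3)[OF u[of "Suc m"], of y] unit_funD(2,3)[OF u[of "Suc m"], of x] Suc.prems
      by (simp add: mult_le_one)
  next
    case True
    interpret ky: prob_space "K y" using in_prob_algebra_halfline(1)[OF kernel_at[OF Suc.prems(1)]] .
    interpret prob_space "pair_kernel (y, x)" by (rule pair_kernel_at[OF Suc.prems])
    have "no_meeting (Suc m) (y, x) \<le> (\<integral>z. 1 - (1 - k m (fst z)) * k m (snd z) \<partial>pair_kernel (y, x))"
      unfolding no_meeting_Suc separated_def
    proof (rule integral_mono)
      show "integrable (pair_kernel (y, x)) (\<lambda>z. if fst z < snd z then no_meeting m z else 0)"
        by (intro integrable_unit_fun2 unit_fun2_restrict unit_fun2_no_meeting Suc.prems)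
      show "integrable (pair_kernel (y, x)) (\<lambda>z. 1 - (1 - k m (fst z)) * k m (snd z))"
        using integral_pair_kernel_product(2)[OF Suc.prems u'[of m] u[of m]] by simp
      show "(if fst z < snd z then no_meeting m z else 0) \<le> 1 - (1 - k m (fst z)) * k m (snd z)"
        if "z \<in> space (pair_kernel (y, x))" for z
        using Suc.IH[of "fst z" "snd z"] that by (auto simp: pair_kernel_at(3)[OF Suc.prems])
    qed
    also have "\<dots> = 1 - (1 - k (Suc m) y) * k (Suc m) x"
    proof -
      have "(\<integral>z. 1 - k m z \<partial>K y) = 1 - k (Suc m) y" "(\<integral>z. k m z \<partial>K x) = k (Suc m) x"
        using integrable_unit_fun[OF kernel_at[OF Suc.prems(1)] u[of m]]
        by (simp_all add: ky.prob_space k_def taboo_def)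
      then show ?thesis
        using integral_pair_kernel_product[OF Suc.prems u'[of m] u[of m]] by (simp add: prob_space)
    qed
    finally show ?thesis using True by simp
  qed
qed

text \<open>If from every pair of states the copies cross with asymptotic probability at least \<open>c\<close>, the
  limit \<open>L\<close> of \<open>no_meeting m\<close> is a fixed point of \<open>separated\<close> below \<open>1 - c\<close>, hence
  \<open>L \<le> (1 - c) no_meeting m\<close> for all \<open>m\<close>.\<close>

lemma no_meeting_tendsto_0:
  assumes k: "\<And>x. 0 \<le> x \<Longrightarrow> (\<lambda>m. (taboo UNIV ^^ m) (indicator {..a}) x) \<longlonglongrightarrow> \<kappa>"
    and pos: "0 < (1 - \<kappa>) * \<kappa>" and yx: "0 \<le> y" "0 \<le> x"
  shows "(\<lambda>m. no_meeting m (y, x)) \<longlonglongrightarrow> 0"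
proof -
  define c where "c = (1 - \<kappa>) * \<kappa>"
  define L where "L w = lim (\<lambda>m. no_meeting m w)" for w
  have lim: "(\<lambda>m. no_meeting m (y, x)) \<longlonglongrightarrow> L (y, x)" if "0 \<le> y" "0 \<le> x" for y x
  proof -
    have "decseq (\<lambda>m. no_meeting m (y, x))"
      using no_meeting_decreasing[OF that] by (rule decseq_SucI)
    then have "convergent (\<lambda>m. no_meeting m (y, x))"
      using unit_fun2D(2)[OF unit_fun2_no_meeting that]
      by (metis decseq_convergent convergentI)
    then show ?thesis by (simp add: L_def convergent_LIMSEQ_iff)
  qed
  have L: "unit_fun2 L"
    unfolding unit_fun2_def
  proof (intro conjI allI impI)
    show "L \<in> borel_measurable (halfline \<Otimes>\<^sub>M halfline)"
      unfolding L_def[abs_def] by (intro borel_measurable_lim_metric unit_fun2D unit_fun2_no_meeting)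
    fix y x :: real assume "0 \<le> y" "0 \<le> x"
    note l = lim[OF this] and b = unit_fun2D(2,3)[OF unit_fun2_no_meeting this]
    show "0 \<le> L (y, x)" using l b by (intro LIMSEQ_le_const) auto
    show "L (y, x) \<le> 1" using l b by (intro LIMSEQ_le_const2) auto
  qed
  have L_fix: "L (y, x) = separated L (y, x)" if yx: "0 \<le> y" "0 \<le> x" for y x
  proof (rule LIMSEQ_unique)
    show "(\<lambda>m. no_meeting (Suc m) (y, x)) \<longlonglongrightarrow> L (y, x)"
      using lim[OF yx] by (rule LIMSEQ_Suc)
    show "(\<lambda>m. no_meeting (Suc m) (y, x)) \<longlonglongrightarrow> separated L (y, x)"
      unfolding no_meeting_Suc separated_def
    proof (rule integral_dominated_convergence[where w="\<lambda>_. 1"])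
      interpret prob_space "pair_kernel (y, x)" by (rule pair_kernel_at[OF yx])
      show "integrable (pair_kernel (y, x)) (\<lambda>_. 1 :: real)" by simp
      show "(\<lambda>z. if fst z < snd z then L z else 0) \<in> borel_measurable (pair_kernel (y, x))"
        "(\<lambda>z. if fst z < snd z then no_meeting m z else 0) \<in> borel_measurable (pair_kernel (y, x))" for m
        using integrable_unit_fun2[OF yx unit_fun2_restrict] L unit_fun2_no_meeting
        by (blast intro: borel_measurable_integrable)+
      show "AE z in pair_kernel (y, x). norm (if fst z < snd z then no_meeting m z else 0) \<le> 1" for m
        using unit_fun2D(2,3)[OF unit_fun2_no_meeting] by (intro AE_I2) (auto simp: pair_kernel_at(3)[OF yx])
      show "AE z in pair_kernel (y, x). (\<lambda>m. if fst z < snd z then no_meeting m z else 0)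
          \<longlonglongrightarrow> (if fst z < snd z then L z else 0)"
        using lim by (intro AE_I2) (auto simp: pair_kernel_at(3)[OF yx])
    qed
  qed
  have L_le: "(if y < x then L (y, x) else 0) \<le> 1 - c" if "0 \<le> y" "0 \<le> x" for y x
  proof (rule LIMSEQ_le)
    show "(\<lambda>m. if y < x then no_meeting m (y, x) else 0) \<longlonglongrightarrow> (if y < x then L (y, x) else 0)"
      using lim[OF that] by simp
    show "(\<lambda>m. 1 - (1 - (taboo UNIV ^^ m) (indicator {..a}) y) * (taboo UNIV ^^ m) (indicator {..a}) x)
        \<longlonglongrightarrow> 1 - c"
      unfolding c_def using that by (intro tendsto_intros k)
  qed (use no_meeting_le[OF that] in blast)
  \<comment> \<open>On the diagonal the guard fails, so the guarded bound reads
    \<open>0 \<le> 1 - c\<close>.\<close>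
  have c1: "c \<le> 1" using L_le[of 0 0] by simp
  have sep_scale: "separated (\<lambda>w. d * f w) w = d * separated f w" for d f w
  proof -
    have "(\<lambda>z. if fst z < snd z then d * f z else 0) = (\<lambda>z. d * (if fst z < snd z then f z else (0::real)))"
      by auto
    then show ?thesis by (simp add: separated_def)
  qed
  \<comment> \<open>The index starts at \<open>Suc m\<close> because \<open>L \<le> 1 - c\<close> is
    known only for pairs with \<open>y < x\<close>; one application of \<open>separated\<close>
    provides that order.\<close>
  have bound: "L (y, x) \<le> (1 - c) * no_meeting (Suc m) (y, x)" if "0 \<le> y" "0 \<le> x" for y x m
    using that
  proof (induction m arbitrary: y x)
    case 0
    have "separated L (y, x) \<le> (\<integral>z. (1 - c) * (if fst z < snd z then 1 else 0) \<partial>pair_kernel (y, x))"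
      unfolding separated_def
    proof (rule integral_mono)
      show "integrable (pair_kernel (y, x)) (\<lambda>z. if fst z < snd z then L z else 0)"
        by (intro integrable_unit_fun2 0 unit_fun2_restrict L)
      show "integrable (pair_kernel (y, x)) (\<lambda>z. (1 - c) * (if fst z < snd z then 1 else 0))"
        by (intro integrable_mult_right integrable_unit_fun2 0 unit_fun2_restrict) (simp add: unit_fun2_def)
      show "(if fst z < snd z then L z else 0) \<le> (1 - c) * (if fst z < snd z then 1 else 0)"
        if "z \<in> space (pair_kernel (y, x))" for z
        using L_le[of "fst z" "snd z"] that by (auto simp: pair_kernel_at(3)[OF 0])
    qed
    then show ?case using L_fix[OF 0] by (simp add: no_meeting_def separated_def)
  next
    case (Suc m)
    have "unit_fun2 (\<lambda>w. (1 - c) * no_meeting (Suc m) w)"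
      using unit_fun2D[OF unit_fun2_no_meeting[of "Suc m"]] c1 pos
      by (auto simp: unit_fun2_def c_def intro!: mult_le_one)
    then have "separated L (y, x) \<le> separated (\<lambda>w. (1 - c) * no_meeting (Suc m) w) (y, x)"
      using Suc by (intro separated_mono L) auto
    then show ?case using L_fix[OF Suc.prems] by (simp add: sep_scale no_meeting_Suc[of "Suc m"])
  qed
  \<comment> \<open>Letting \<open>m\<close> grow replaces \<open>no_meeting\<close> by its limit;
    as \<open>c > 0\<close>, a nonnegative number bounded by \<open>1 - c\<close> times itself is
    0.\<close>
  have "L (y, x) \<le> (1 - c) * L (y, x)"
    using LIMSEQ_Suc[OF lim[OF yx]] bound[OF yx]
    by (intro LIMSEQ_le_const[OF tendsto_mult_left]) auto
  then have "c * L (y, x) \<le> 0" by (simp add: algebra_simps)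
  then have "L (y, x) = 0"
    using pos unit_fun2D(2)[OF L yx] by (simp add: c_def[symmetric] mult_le_0_iff)
  then show ?thesis using lim[OF yx] by simp
qed

end

section \<open>Survival from two starting points, compared through the coupling\<close>

context monotone_kernel
begin

text \<open>Once the copy from \<open>y\<close> has caught up with the copy from \<open>x\<close>
  while the latter is still in \<open>[0, A]\<close>, monotonicity gives it no better chance to
  survive. Two events spoil this: no meeting by time \<open>m\<close>, or exit of the copy from
  \<open>x\<close> within \<open>m\<close> steps. The bound is free of \<open>n\<close>; in the
  induction the horizon \<open>m\<close> shrinks along with \<open>n\<close>.\<close>

lemma surv_diff_le_no_meeting:
  assumes yx: "0 \<le> y" "0 \<le> x"
  shows "surv A n y - surv A n x \<le> no_meeting m (y, x) + 1 - surv A m x"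
  using yx
proof (induction n arbitrary: m y x)
  case 0
  then show ?case
    using unit_fun2D(2)[OF unit_fun2_no_meeting[of m]] unit_funD(3)[OF unit_fun_surv[of m A]]
    by (smt (verit) funpow_0)
next
  case (Suc n)
  show ?case
  proof (cases m)
    case 0
    then show ?thesis
      using unit_funD(2,3)[OF unit_fun_surv[of "Suc n" A]] Suc.prems
      by (smt (verit) funpow_0 no_meeting_def)
  next
    case (Suc m')
    let ?S = "\<lambda>n z. indicator {..A} z * surv A n z"
    let ?D = "\<lambda>z. if fst z < snd z then no_meeting m' z else 0"
    let ?pk = "pair_kernel (y, x)"
    interpret prob_space ?pk by (rule pair_kernel_at[OF Suc.prems])
    note u = unit_fun_killed[of A]
    have int: "integrable ?pk (\<lambda>z. ?S n (fst z))" "integrable ?pk (\<lambda>z. ?S n (snd z))"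
      "integrable ?pk (\<lambda>z. ?S m' (snd z))" "integrable ?pk ?D"
      by (intro integrable_unit_fun2 Suc.prems unit_fun2_fst unit_fun2_snd u unit_fun2_restrict unit_fun2_no_meeting)+
    \<comment> \<open>Three cases for the arrival pair: for \<open>a > A\<close> the last term is 1;
      for \<open>b < a \<le> A\<close> the induction hypothesis with the shorter horizon applies;
      for \<open>a \<le> b\<close> the left side is at most 0.\<close>
    have pw: "?S n b - ?S n a \<le> ?D (b, a) + (1 - ?S m' a)" if "0 \<le> b" "0 \<le> a" for b a
    proof (cases "a \<le> A")
      case False
      then show ?thesis
        using unit_fun2D(2)[OF unit_fun2_no_meeting[of m'] that] unit_funD(3)[OF u[of n] that(1)] by simp
    next
      case True
      show ?thesis
      proof (cases "b < a")
        case True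
        then show ?thesis using \<open>a \<le> A\<close> Suc.IH[OF that, of m'] by simp
      next
        case False
        then have "?S n b \<le> ?S n a"
          using monotone_onD[OF antimono_killed[OF antimono_surv[of n A]], of a b] that by simp
        then show ?thesis using False unit_funD(3)[OF u[of m'] that(2)] by simp
      qed
    qed
    have "surv A (Suc n) y - surv A (Suc n) x = (\<integral>z. ?S n (fst z) - ?S n (snd z) \<partial>?pk)"
      using int integral_pair_kernel_fst[OF Suc.prems u] integral_pair_kernel_snd[OF Suc.prems u]
      unfolding surv_Suc by simp
    also have "\<dots> \<le> (\<integral>z. ?D z + (1 - ?S m' (snd z)) \<partial>?pk)"
    proof (rule integral_mono)
      show "?S n (fst z) - ?S n (snd z) \<le> ?D z + (1 - ?S m' (snd z))" if "z \<in> space ?pk" for z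
        using pw[of "fst z" "snd z"] that by (simp only: pair_kernel_at(3)[OF Suc.prems] mem_Times_iff atLeast_iff prod.collapse fst_conv snd_conv)
    qed (use int in simp_all)
    also have "\<dots> = no_meeting (Suc m') (y, x) + 1 - surv A (Suc m') x"
      using int integral_pair_kernel_snd[OF Suc.prems u] unfolding surv_Suc
      by (simp add: no_meeting_Suc separated_def prob_space)
    finally show ?thesis using Suc by simp
  qed
qed

text \<open>First \<open>m\<close> makes the meeting term small, then a large \<open>A\<close> makes
  exit within \<open>m\<close> steps unlikely; \<open>n\<close> never enters these choices.\<close>

lemma surv_diff_uniformly_small:
  assumes yx: "0 \<le> y" "0 \<le> x" and lim: "(\<lambda>m. no_meeting m (y, x)) \<longlonglongrightarrow> 0" and "0 < \<delta>"
  shows "\<forall>\<^sub>F A in at_top. \<forall>n. surv A n y - surv A n x \<le> \<delta>"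
proof -
  have "\<forall>\<^sub>F m in sequentially. no_meeting m (y, x) < \<delta> / 2"
    using lim \<open>0 < \<delta>\<close> by (intro order_tendstoD) auto
  then obtain m where m: "no_meeting m (y, x) < \<delta> / 2" by (auto simp: eventually_sequentially)
  have "\<forall>\<^sub>F A in at_top. 1 - \<delta> / 2 < surv A m x"
    using surv_tendsto_1[OF yx(2), of m] \<open>0 < \<delta>\<close> by (intro order_tendstoD) auto
  then show ?thesis
  proof eventually_elim
    case (elim A)
    show ?case
    proof
      fix n show "surv A n y - surv A n x \<le> \<delta>"
        using surv_diff_le_no_meeting[OF yx, of n A m] m elim by linarith
    qed
  qed
qed

end

section \<open>Tail integrals, geometric laws and the quasi-stationary eigenvalue\<close>

text \<open>These Gamma integrals are the moments of the exponential density with its factor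
  \<open>l\<close> divided out.\<close>

lemma has_bochner_integral_exp_power:
  fixes l :: real
  assumes l: "0 < l"
  shows "has_bochner_integral lborel (\<lambda>s. indicator {0..} s * (s ^ i * exp (- l * s))) (fact i / l ^ (i + 1))"
proof -
  have "has_bochner_integral lborel (\<lambda>s. exponential_density l s * s ^ i) (fact i / l ^ i)"
    using l nn_integral_erlang_ith_moment[OF l, of 0 i]
    by (intro has_bochner_integral_nn_integral) (auto intro!: AE_I2 simp: exponential_density_def)
  from has_bochner_integral_mult_right[OF this, of "1 / l"]
  have "has_bochner_integral lborel (\<lambda>s. 1 / l * (exponential_density l s * s ^ i)) (1 / l * (fact i / l ^ i))"
    by simp
  moreover have "1 / l * (exponential_density l s * s ^ i) = indicator {0..} s * (s ^ i * exp (- l * s))" for s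
    using l by (simp add: exponential_density_def mult.commute split: split_indicator)
  ultimately show ?thesis by (simp add: mult.commute)
qed

text \<open>Dominated convergence in the tail formula: the growth of \<open>g\<close> against the
  decay of the tail leaves the majorant \<open>B * C * exp (- (r - t) * s)\<close>, integrable
  because \<open>t < r\<close>.\<close>

lemma tail_moment_limit:
  fixes M :: "'a measure" and Y :: "real \<Rightarrow> 'a \<Rightarrow> real"
  assumes prob: "prob_space M" and Y [measurable]: "\<And>A. Y A \<in> borel_measurable M"
    and nonneg: "\<forall>\<^sub>F A in at_top. \<forall>\<omega>\<in>space M. 0 \<le> Y A \<omega>"
    and lim: "\<And>s. 0 \<le> s \<Longrightarrow> ((\<lambda>A. \<P>(\<omega> in M. s < Y A \<omega>)) \<longlongrightarrow> exp (- s)) at_top"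
    and bound: "\<forall>\<^sub>F A in at_top. \<forall>s\<ge>0. \<P>(\<omega> in M. s < Y A \<omega>) \<le> C * exp (- r * s)"
    and deriv: "\<And>s. (G has_real_derivative g s) (at s)" and cont: "\<And>s. isCont g s"
    and growth: "\<And>s. 0 \<le> s \<Longrightarrow> \<bar>g s\<bar> \<le> B * exp (t * s)" and "t < r"
  shows "\<forall>\<^sub>F A in at_top. integrable M (\<lambda>\<omega>. G (Y A \<omega>))"
    and "((\<lambda>A. \<integral>\<omega>. G (Y A \<omega>) \<partial>M) \<longlongrightarrow> G 0 + (\<integral>s. indicator {0..} s * g s * exp (- s) \<partial>lborel)) at_top"
proof -
  interpret prob_space M by fact
  let ?p = "\<lambda>A s. \<P>(\<omega> in M. s < Y A \<omega>)"
  have [measurable]: "g \<in> borel_measurable borel"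
    using cont by (intro borel_measurable_continuous_onI continuous_at_imp_continuous_on) auto
  have p_meas [measurable]: "?p A \<in> borel_measurable borel" for A
  proof -
    have "mono (\<lambda>s. - ?p A s)"
      by (intro monoI le_imp_neg_le finite_measure_mono) auto
    then have "(\<lambda>s. - ?p A s) \<in> borel_measurable borel" by (rule borel_measurable_mono)
    then show ?thesis by simp
  qed
  define w where "w s = indicator {0..} s * (B * C * exp (- (r - t) * s))" for s :: real
  have w: "integrable lborel w"
  proof -
    have "integrable lborel (\<lambda>s. (B * C) * (indicator {0..} s * (s ^ 0 * exp (- (r - t) * s))))"
      using has_bochner_integral_exp_power[of "r - t" 0] \<open>t < r\<close>
      by (intro integrable_mult_right) (simp add: has_bochner_integral_iff)
    then show ?thesis by (simp add: w_def[abs_def] mult_ac)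
  qed
  have dom: "\<forall>\<^sub>F A in at_top. \<forall>s. \<bar>indicator {0..} s * g s * ?p A s\<bar> \<le> w s"
    using bound
  proof eventually_elim
    case (elim A)
    show ?case
    proof
      fix s :: real
      show "\<bar>indicator {0..} s * g s * ?p A s\<bar> \<le> w s"
      proof (cases "0 \<le> s")
        case True
        have "\<bar>g s\<bar> * ?p A s \<le> (B * exp (t * s)) * (C * exp (- r * s))"
          using growth[OF True] elim True abs_ge_zero[of "g s"]
          by (intro mult_mono) (auto intro: order_trans)
        also have "\<dots> = B * C * exp (- (r - t) * s)"
          by (simp add: algebra_simps flip: exp_add)
        finally show ?thesis using True by (simp add: w_def abs_mult)
      qed (simp add: w_def)
    qed
  qed
  have int: "integrable lborel (\<lambda>s. indicator {0..} s * \<bar>g s\<bar> * ?p A s)"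
    if "\<forall>s. \<bar>indicator {0..} s * g s * ?p A s\<bar> \<le> w s" for A
  proof (rule Bochner_Integration.integrable_bound[OF w])
    have "norm (indicator {0..} s * \<bar>g s\<bar> * ?p A s) \<le> norm (w s)" for s
      using that[rule_format, of s] by (simp add: abs_mult)
    then show "AE s in lborel. norm (indicator {0..} s * \<bar>g s\<bar> * ?p A s) \<le> norm (w s)" by simp
  qed measurable
  note formula = tail_integral[OF prob Y _ deriv cont int]
  show "\<forall>\<^sub>F A in at_top. integrable M (\<lambda>\<omega>. G (Y A \<omega>))"
    using nonneg dom
  proof eventually_elim
    case (elim A)
    then show ?case by (intro formula(1)) auto
  qed
  have "((\<lambda>A. \<integral>s. indicator {0..} s * g s * ?p A s \<partial>lborel)
      \<longlongrightarrow> (\<integral>s. indicator {0..} s * g s * exp (- s) \<partial>lborel)) at_top"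
  proof (rule integral_dominated_convergence_at_top[OF _ _ w])
    show "\<forall>\<^sub>F A in at_top. AE s in lborel. norm (indicator {0..} s * g s * ?p A s) \<le> w s"
      using dom by eventually_elim simp
    have "((\<lambda>A. indicator {0..} s * g s * ?p A s) \<longlongrightarrow> indicator {0..} s * g s * exp (- s)) at_top" for s
      using lim[of s] by (cases "0 \<le> s") (auto intro: tendsto_mult_left)
    then show "AE s in lborel. ((\<lambda>A. indicator {0..} s * g s * ?p A s) \<longlongrightarrow> indicator {0..} s * g s * exp (- s)) at_top"
      by simp
  qed measurable
  from tendsto_add[OF tendsto_const[of "G 0"] this]
  show "((\<lambda>A. \<integral>\<omega>. G (Y A \<omega>) \<partial>M) \<longlongrightarrow> G 0 + (\<integral>s. indicator {0..} s * g s * exp (- s) \<partial>lborel)) at_top"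
  proof (rule Lim_transform_eventually)
    show "\<forall>\<^sub>F A in at_top. G 0 + (\<integral>s. indicator {0..} s * g s * ?p A s \<partial>lborel) = (\<integral>\<omega>. G (Y A \<omega>) \<partial>M)"
      using nonneg dom
    proof eventually_elim
      case (elim A)
      then show ?case by (intro formula(2)[symmetric]) auto
    qed
  qed
qed

text \<open>With \<open>n = nat \<lfloor>s / p A\<rfloor>\<close> the power is the exponential of
  \<open>(n * p A) * (ln (1 - p A) / p A)\<close>. The first factor tends to \<open>s\<close>
  because rounding costs at most \<open>p A\<close>, the second to the derivative -1 of
  \<open>ln (1 - x)\<close> at 0.\<close>

lemma geometric_tendsto_exp:
  fixes p :: "'b \<Rightarrow> real"
  assumes p0: "(p \<longlongrightarrow> 0) F" and pos: "\<forall>\<^sub>F A in F. 0 < p A" and s: "0 \<le> s"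
  shows "((\<lambda>A. (1 - p A) ^ nat \<lfloor>s / p A\<rfloor>) \<longlongrightarrow> exp (- s)) F"
proof -
  have "((\<lambda>x::real. ln (1 - x)) has_real_derivative - 1) (at 0)"
    by (auto intro!: derivative_eq_intros)
  then have "((\<lambda>x::real. ln (1 - x) / x) \<longlongrightarrow> - 1) (at 0)"
    by (simp add: has_field_derivative_iff)
  moreover have "filterlim p (at 0) F"
    using p0 eventually_mono[OF pos, of "\<lambda>A. p A \<noteq> 0"] by (simp add: filterlim_at)
  ultimately have 1: "((\<lambda>A. ln (1 - p A) / p A) \<longlongrightarrow> - 1) F"
    by (rule filterlim_compose)
  have 2: "((\<lambda>A. real (nat \<lfloor>s / p A\<rfloor>) * p A) \<longlongrightarrow> s) F"
  proof (rule tendsto_sandwich)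
    have b: "s - p A \<le> real (nat \<lfloor>s / p A\<rfloor>) * p A \<and> real (nat \<lfloor>s / p A\<rfloor>) * p A \<le> s" if "0 < p A" for A
    proof -
      have n: "real (nat \<lfloor>s / p A\<rfloor>) = of_int \<lfloor>s / p A\<rfloor>" using s that by simp
      have "of_int \<lfloor>s / p A\<rfloor> * p A \<le> (s / p A) * p A" "(s / p A - 1) * p A \<le> of_int \<lfloor>s / p A\<rfloor> * p A"
        using that by (intro mult_right_mono; linarith)+
      then show ?thesis using that unfolding n by (simp add: left_diff_distrib)
    qed
    show "\<forall>\<^sub>F A in F. s - p A \<le> real (nat \<lfloor>s / p A\<rfloor>) * p A"
      using pos by eventually_elim (use b in blast)
    show "\<forall>\<^sub>F A in F. real (nat \<lfloor>s / p A\<rfloor>) * p A \<le> s"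
      using pos by eventually_elim (use b in blast)
    show "((\<lambda>A. s - p A) \<longlongrightarrow> s) F" using tendsto_diff[OF tendsto_const p0, of s] by simp
  qed simp
  have "((\<lambda>A. exp ((real (nat \<lfloor>s / p A\<rfloor>) * p A) * (ln (1 - p A) / p A))) \<longlongrightarrow> exp (s * - 1)) F"
    by (intro tendsto_exp tendsto_mult 1 2)
  then have "((\<lambda>A. exp ((real (nat \<lfloor>s / p A\<rfloor>) * p A) * (ln (1 - p A) / p A))) \<longlongrightarrow> exp (- s)) F" by simp
  then show ?thesis
  proof (rule Lim_transform_eventually)
    have "\<forall>\<^sub>F A in F. p A < 1" using p0 by (rule order_tendstoD) simp
    with pos show "\<forall>\<^sub>F A in F. exp ((real (nat \<lfloor>s / p A\<rfloor>) * p A) * (ln (1 - p A) / p A)) = (1 - p A) ^ nat \<lfloor>s / p A\<rfloor>"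
    proof eventually_elim
      case (elim A)
      then have "(real (nat \<lfloor>s / p A\<rfloor>) * p A) * (ln (1 - p A) / p A) = real (nat \<lfloor>s / p A\<rfloor>) * ln (1 - p A)" by simp
      then show ?case using elim by (simp only: exp_of_nat_mult) simp
    qed
  qed
qed

lemma Collect_le_eq: "\<mu> \<in> space (prob_algebra halfline) \<Longrightarrow> {z \<in> space \<mu>. z \<le> y} = {0..y}"
  using in_prob_algebra_halfline(3) by auto

lemma return_halfline: "0 \<le> x \<Longrightarrow> return halfline x \<in> space (prob_algebra halfline)"
  by (simp add: space_prob_algebra prob_space_return)

section \<open>What the hypotheses on the process say about the kernel and the exit time\<close>

context markov_chain
begin

lemma integral_return_halfline: "0 \<le> x \<Longrightarrow> unit_fun f \<Longrightarrow> (\<integral>z. f z \<partial>return halfline x) = f x"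
  using unit_funD(1) by (intro integral_return) auto

lemma start_prob_exit:
  assumes "0 \<le> x" and B: "B \<in> sets borel"
  shows "\<P>(\<omega> in start P x. X n \<omega> \<in> B \<and> exit_time X A \<omega> > enat n) = (taboo {..A} ^^ n) (indicator B) x"
  unfolding start_def prob_exit[OF return_halfline[OF assms(1)] B]
  by (intro integral_return_halfline assms unit_fun_taboo_pow unit_fun_indicator) simp

lemma start_prob_marginal:
  assumes "0 \<le> x" and B: "B \<in> sets borel"
  shows "\<P>(\<omega> in start P x. X n \<omega> \<in> B) = (taboo UNIV ^^ n) (indicator B) x"
  unfolding start_def prob_marginal[OF return_halfline[OF assms(1)] B]
  by (intro integral_return_halfline assms unit_fun_taboo_pow unit_fun_indicator) simp

lemma start_prob_1:
  assumes x: "0 \<le> x" and B: "B \<in> sets borel"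
  shows "\<P>(\<omega> in start P x. X 1 \<omega> \<in> B) = measure (K x) (B \<inter> {0..})"
  using start_prob_marginal[OF x B, of 1] in_prob_algebra_halfline(3)[OF kernel_at[OF x]]
  by (simp add: taboo_UNIV)

text \<open>Stochastic monotonicity speaks of closed upper tails, while the complement of
  \<open>{0..y}\<close> is an open one; the closed tails from \<open>y + 1 / Suc n\<close> increase
  to it.\<close>

lemma kernel_stoch_mono:
  assumes mono: "stochastically_monotone P X" and x: "0 \<le> x" "x \<le> x'"
  shows "measure (K x') {0..y} \<le> measure (K x) {0..y}"
proof -
  define U where "U n = {y + 1 / Suc n..} \<inter> {0..}" for n :: nat
  have le: "measure (K x) (U n) \<le> measure (K x') (U n)" for n
  proof -
    have eq: "\<P>(\<omega> in start P x. X 1 \<omega> \<ge> c) = measure (K x) ({c..} \<inter> {0..})" if "0 \<le> x" for x c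
      using start_prob_1[OF that, of "{c..}"] by simp
    have "mono_on {0..} (\<lambda>x. \<P>(\<omega> in start P x. X 1 \<omega> \<ge> y + 1 / Suc n))"
      using mono unfolding stochastically_monotone_def by blast
    from mono_onD[OF this, of x x'] show ?thesis
      using x order_trans[OF x] by (simp only: eq U_def atLeast_iff)
  qed
  have UU: "(\<Union>n. U n) = {y<..} \<inter> {0..}"
  proof (intro set_eqI iffI)
    fix z assume z: "z \<in> {y<..} \<inter> {0..}"
    then obtain n where "1 / Suc n < z - y" using nat_approx_posE[of "z - y"] by auto
    then have "z \<in> U n" using z by (auto simp: U_def)
    then show "z \<in> (\<Union>n. U n)" by auto
  next
    fix z assume "z \<in> (\<Union>n. U n)"
    then obtain n where "y + 1 / Suc n \<le> z" "0 \<le> z" by (auto simp: U_def)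
    moreover have "0 < 1 / real (Suc n)" by simp
    ultimately have "y < z" by linarith
    then show "z \<in> {y<..} \<inter> {0..}" using \<open>0 \<le> z\<close> by simp
  qed
  have inc: "incseq U"
  proof (rule incseq_SucI)
    fix n
    have "1 / real (Suc (Suc n)) \<le> 1 / real (Suc n)" by (simp add: field_simps)
    then have "y + 1 / real (Suc (Suc n)) \<le> y + 1 / real (Suc n)" by (rule add_left_mono)
    then show "U n \<subseteq> U (Suc n)" unfolding U_def by (intro Int_mono) (simp_all add: atLeast_subset_iff)
  qed
  have meas: "range U \<subseteq> sets halfline" by (auto simp: U_def sets_halfline)
  have lim: "(\<lambda>n. measure (K x) (U n)) \<longlonglongrightarrow> measure (K x) ({y<..} \<inter> {0..})"
    and compl: "measure (K x) {0..y} = 1 - measure (K x) ({y<..} \<inter> {0..})" if "0 \<le> x" for x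
  proof -
    note H = in_prob_algebra_halfline[OF kernel_at[OF that]]
    interpret prob_space "K x" by (rule H)
    show "(\<lambda>n. measure (K x) (U n)) \<longlonglongrightarrow> measure (K x) ({y<..} \<inter> {0..})"
      unfolding UU[symmetric] using inc meas H(2) by (intro finite_Lim_measure_incseq) auto
    have "measure (K x) (space (K x) - {y<..} \<inter> {0..}) = 1 - measure (K x) ({y<..} \<inter> {0..})"
      by (rule prob_compl) (simp add: H(2) sets_halfline)
    moreover have "space (K x) - {y<..} \<inter> {0..} = {0..y}" unfolding H(3) by (rule set_eqI) (simp, linarith)
    ultimately show "measure (K x) {0..y} = 1 - measure (K x) ({y<..} \<inter> {0..})" by simp
  qed
  have x': "0 \<le> x'" using x by simp
  have "measure (K x) ({y<..} \<inter> {0..}) \<le> measure (K x') ({y<..} \<inter> {0..})"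
    using le by (intro LIMSEQ_le[OF lim[OF x(1)] lim[OF x']]) auto
  then show ?thesis using compl[OF x(1)] compl[OF x'] by simp
qed

text \<open>Given survival of the first step, \<open>X 1\<close> again has law \<open>Q\<close>.
  Undoing the normalisation makes \<open>Q\<close> a left eigenvector of \<open>taboo {..A}\<close>
  with eigenvalue \<open>\<rho>\<close>.\<close>

lemma quasi_stationary_eigen:
  assumes qs: "quasi_stationary P X A Q" and f: "unit_fun f"
  defines "\<rho> \<equiv> \<P>(\<omega> in P Q. X 1 \<omega> \<le> A)"
  shows "0 < \<rho>" and "(\<integral>z. taboo {..A} f z \<partial>Q) = \<rho> * (\<integral>z. f z \<partial>Q)"
proof -
  have Q: "Q \<in> space (prob_algebra halfline)" using qs by (simp add: quasi_stationary_def)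
  note HQ = in_prob_algebra_halfline[OF Q]
  interpret Q: prob_space Q by (rule HQ)
  interpret prob_space "P Q" by (rule prob_space_P[OF Q])
  note [measurable] = X_measurable[OF Q] X_borel[OF Q]
  define E where "E = {\<omega> \<in> space (P Q). X 1 \<omega> \<le> A}"
  have E [measurable]: "E \<in> sets (P Q)" unfolding E_def by measurable
  have \<rho>E: "\<rho> = prob E" by (simp add: \<rho>_def E_def)
  have cond: "prob {\<omega> \<in> space (P Q). X 1 \<omega> \<in> B \<and> X 1 \<omega> \<le> A} / \<rho> = measure Q B" if "B \<in> sets halfline" for B
  proof -
    have "\<P>(\<omega> in P Q. X 1 \<omega> \<in> B \<bar> exit_time X A \<omega> > enat 1) = measure Q B"
      using qs that unfolding quasi_stationary_def by blast
    then show ?thesis unfolding cond_prob_def exit_time_gt_iff \<rho>_def by simp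
  qed
  have "prob {\<omega> \<in> space (P Q). X 1 \<omega> \<in> {0..} \<and> X 1 \<omega> \<le> A} / \<rho> = 1"
    using cond[of "{0..}"] Q.prob_space HQ(3) by (simp add: sets_halfline)
  \<comment> \<open>Division by 0 yields 0, so a vanishing \<open>\<rho>\<close> could not give
    total mass 1.\<close>
  then have "\<rho> \<noteq> 0" by auto
  then show pos: "0 < \<rho>" unfolding \<rho>_def using measure_nonneg less_eq_real_def by metis
  have eE: "emeasure (P Q) E = ennreal \<rho>" by (simp add: \<rho>E emeasure_eq_measure)
  \<comment> \<open>The conditional law of the path given survival of the first step.\<close>
  define U where "U = uniform_measure (P Q) E"
  have sU [measurable_cong]: "sets U = sets (P Q)" by (simp add: U_def)
  have distrU: "distr U halfline (X 1) = Q"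
  proof (rule measure_eqI)
    fix B assume "B \<in> sets (distr U halfline (X 1))"
    then have B [measurable]: "B \<in> sets halfline" by simp
    have "emeasure (distr U halfline (X 1)) B = emeasure U (X 1 -` B \<inter> space (P Q))"
      using sets_eq_imp_space_eq[OF sU] by (subst emeasure_distr) auto
    also have "\<dots> = emeasure (P Q) (E \<inter> (X 1 -` B \<inter> space (P Q))) / emeasure (P Q) E"
      unfolding U_def by (intro emeasure_uniform_measure) auto
    also have "E \<inter> (X 1 -` B \<inter> space (P Q)) = {\<omega> \<in> space (P Q). X 1 \<omega> \<in> B \<and> X 1 \<omega> \<le> A}"
      by (auto simp: E_def)
    also have "emeasure (P Q) \<dots> / emeasure (P Q) E = emeasure Q B"
      using cond[OF B] pos
      by (simp add: emeasure_eq_measure Q.emeasure_eq_measure \<rho>E[symmetric] divide_ennreal)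
    finally show "emeasure (distr U halfline (X 1)) B = emeasure Q B" .
  qed (simp add: HQ(2))
  have fm [measurable]: "f \<in> borel_measurable halfline" by (rule unit_funD[OF f])
  have "(\<integral>z. f z \<partial>Q) = (\<integral>\<omega>. f (X 1 \<omega>) \<partial>U)"
    unfolding distrU[symmetric] by (intro integral_distr) auto
  also have "U = density (P Q) (\<lambda>\<omega>. ennreal (indicator E \<omega> / \<rho>))"
    unfolding U_def uniform_measure_def eE
  proof (intro density_cong AE_I2)
    show "indicator E \<omega> / ennreal \<rho> = ennreal (indicator E \<omega> / \<rho>)" for \<omega>
      using divide_ennreal[of "indicator E \<omega>" \<rho>] pos by (simp split: split_indicator_asm)
  qed measurable
  also have "(\<integral>\<omega>. f (X 1 \<omega>) \<partial>\<dots>) = (\<integral>\<omega>. indicator E \<omega> / \<rho> * f (X 1 \<omega>) \<partial>P Q)"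
    using pos by (subst integral_density) auto
  also have "\<dots> = (\<integral>\<omega>. indicator E \<omega> * f (X 1 \<omega>) \<partial>P Q) / \<rho>"
    by simp
  also have "(\<integral>\<omega>. indicator E \<omega> * f (X 1 \<omega>) \<partial>P Q) = (\<integral>z. taboo {..A} f z \<partial>Q)"
    using taboo_law[OF Q _ f, of "{..A}" 1] by (simp add: E_def)
  finally show "(\<integral>z. taboo {..A} f z \<partial>Q) = \<rho> * (\<integral>z. f z \<partial>Q)" using pos by (simp add: field_simps)
qed

text \<open>An \<open>enat\<close> is determined by the naturals below it, so each event
  \<open>exit_time X A \<omega> = a\<close> is a countable combination of conditions on the
  \<open>X i\<close>; as the codomain is countable, single points suffice.\<close>

lemma exit_time_measurable [measurable]:
  assumes G: "G \<in> space (prob_algebra halfline)"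
  shows "exit_time X A \<in> P G \<rightarrow>\<^sub>M count_space UNIV"
proof -
  note [measurable] = X_borel[OF G]
  have eq: "exit_time X A \<omega> = a \<longleftrightarrow> (\<forall>n. (\<forall>i\<in>{1..n}. X i \<omega> \<le> A) \<longleftrightarrow> enat n < a)" for \<omega> a
  proof
    assume *: "\<forall>n. (\<forall>i\<in>{1..n}. X i \<omega> \<le> A) \<longleftrightarrow> enat n < a"
    then have *: "enat n < exit_time X A \<omega> \<longleftrightarrow> enat n < a" for n
      by (simp add: exit_time_gt_iff)
    show "exit_time X A \<omega> = a"
    proof (rule linorder_cases)
      assume "exit_time X A \<omega> < a"
      then show ?thesis using *[of "the_enat (exit_time X A \<omega>)"] by (cases "exit_time X A \<omega>") auto
    next
      assume "a < exit_time X A \<omega>"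
      then show ?thesis using *[of "the_enat a"] by (cases a) auto
    qed
  qed (metis exit_time_gt_iff)
  have "exit_time X A -` {a} \<inter> space (P G) = {\<omega> \<in> space (P G). \<forall>n. (\<forall>i\<in>{1..n}. X i \<omega> \<le> A) \<longleftrightarrow> enat n < a}" for a
    using eq by auto
  moreover have "{\<omega> \<in> space (P G). \<forall>n. (\<forall>i\<in>{1..n}. X i \<omega> \<le> A) \<longleftrightarrow> enat n < a} \<in> sets (P G)" for a
    by measurable
  ultimately show ?thesis
    by (subst measurable_count_space_eq2_countable) auto
qed

lemma exit_time_real_measurable:
  assumes G: "G \<in> space (prob_algebra halfline)"
  shows "exit_time_real X A \<in> borel_measurable (P G)"
  unfolding exit_time_real_def[abs_def]
  by (rule measurable_compose[OF exit_time_measurable[OF G]]) simp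

end

section \<open>Comparison with the geometric law\<close>

locale exit_chain = markov_chain K P X + monotone_kernel K
  for K :: "real \<Rightarrow> real measure" and P :: "real measure \<Rightarrow> 'w measure" and X :: "nat \<Rightarrow> 'w \<Rightarrow> real" +
  fixes H :: "real measure" and HA :: "real \<Rightarrow> real measure" and p :: "real \<Rightarrow> real"
  assumes C1_stationary: "stationary P X H"
    and C1_limit: "\<And>x y. x \<ge> 0 \<Longrightarrow>
          (\<lambda>n. \<P>(\<omega> in start P x. X n \<omega> \<le> y)) \<longlonglongrightarrow> \<P>(z in H. z \<le> y)"
    and C1_support: "measure_support H = {0..}"
    and C2_quasi_stationary: "\<And>A. A > 0 \<Longrightarrow> quasi_stationary P X A (HA A)"
    and C2_limit: "\<And>A x y. A > 0 \<Longrightarrow> 0 \<le> x \<Longrightarrow> x < A \<Longrightarrow>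
          (\<lambda>n. \<P>(\<omega> in start P x. X n \<omega> \<le> y \<bar> exit_time X A \<omega> > enat n))
            \<longlonglongrightarrow> \<P>(z in HA A. z \<le> y)"
    and p_def: "\<And>A. A > 0 \<Longrightarrow> p A = \<P>(\<omega> in P (HA A). X 1 \<omega> > A)"
begin

definition h :: "real \<Rightarrow> real" where
  "h y = measure H {0..y}"

lemma H_prob: "H \<in> space (prob_algebra halfline)"
  using C1_stationary by (simp add: stationary_def)

lemma HA_prob: "0 < A \<Longrightarrow> HA A \<in> space (prob_algebra halfline)"
  using C2_quasi_stationary by (simp add: quasi_stationary_def)

lemma start_cdf: "0 \<le> x \<Longrightarrow> \<P>(\<omega> in start P x. X n \<omega> \<le> y) = (taboo UNIV ^^ n) (indicator {..y}) x"
  using start_prob_marginal[of x "{..y}" n] by simp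

lemma start_surv: "0 \<le> x \<Longrightarrow> \<P>(\<omega> in start P x. exit_time X A \<omega> > enat n) = surv A n x"
  using start_prob_exit[of x UNIV n A] by (simp add: indicator_def)

lemma cdf_limit: "0 \<le> x \<Longrightarrow> (\<lambda>n. (taboo UNIV ^^ n) (indicator {..y}) x) \<longlonglongrightarrow> h y"
  using C1_limit[of x y] by (simp add: start_cdf Collect_le_eq[OF H_prob] h_def)

text \<open>Full support enters through the neighbourhood \<open>{..<y}\<close> of 0 and, for the
  upper bound that follows, through the neighbourhood \<open>{y<..}\<close> of
  \<open>y + 1\<close>.\<close>

lemma h_pos: "0 < y \<Longrightarrow> 0 < h y"
proof -
  assume y: "0 < y"
  note HH = in_prob_algebra_halfline[OF H_prob]
  interpret prob_space H by (rule HH)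
  have "0 \<in> measure_support H" using C1_support by simp
  then have "\<forall>U. open U \<longrightarrow> 0 \<in> U \<longrightarrow> emeasure H (U \<inter> space H) \<noteq> 0"
    unfolding measure_support_def mem_Collect_eq by (rule conjunct2)
  from this[rule_format, of "{..<y}"] have "emeasure H ({..<y} \<inter> space H) \<noteq> 0"
    using y by simp
  then have "0 < measure H ({..<y} \<inter> space H)"
    by (simp add: emeasure_eq_measure zero_less_measure_iff)
  also have "\<dots> \<le> h y"
    unfolding h_def HH(3) by (intro finite_measure_mono subsetI) (simp_all add: HH(2) sets_halfline)
  finally show ?thesis .
qed

lemma h_less_1: "0 \<le> y \<Longrightarrow> h y < 1"
proof -
  assume y: "0 \<le> y"
  note HH = in_prob_algebra_halfline[OF H_prob]
  interpret prob_space H by (rule HH)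
  have "y + 1 \<in> measure_support H" using C1_support y by simp
  then have "\<forall>U. open U \<longrightarrow> y + 1 \<in> U \<longrightarrow> emeasure H (U \<inter> space H) \<noteq> 0"
    unfolding measure_support_def mem_Collect_eq by (rule conjunct2)
  from this[rule_format, of "{y<..}"] have "emeasure H ({y<..} \<inter> space H) \<noteq> 0"
    by simp
  then have "0 < measure H ({y<..} \<inter> space H)"
    by (simp add: emeasure_eq_measure zero_less_measure_iff)
  also have "\<dots> \<le> measure H (space H - {0..y})"
    unfolding HH(3) by (intro finite_measure_mono subsetI) (simp_all add: HH(2) sets_halfline subset_eq)
  also have "\<dots> = 1 - h y"
    unfolding h_def by (intro prob_compl) (simp add: HH sets_halfline)
  finally show ?thesis by simp
qed

lemma h_tendsto_1: "(h \<longlongrightarrow> 1) at_top"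
proof -
  note HH = in_prob_algebra_halfline[OF H_prob]
  interpret prob_space H by (rule HH)
  have "((\<lambda>y. \<integral>z. indicat_real {..y} z \<partial>H) \<longlongrightarrow> (\<integral>z. 1 \<partial>H)) at_top"
  proof (rule integral_dominated_convergence_at_top[where w="\<lambda>_. 1" and s="\<lambda>y. indicat_real {..y}"])
    show "(\<lambda>z. indicat_real {..y} z) \<in> borel_measurable H" for y
      by (intro borel_measurable_integrable integrable_unit_fun[OF H_prob] unit_fun_indicator) simp
    have "((\<lambda>y. indicat_real {..y} z) \<longlongrightarrow> 1) at_top" for z :: real
    proof (rule Lim_transform_eventually[OF tendsto_const])
      show "\<forall>\<^sub>F y in at_top. 1 = indicat_real {..y} z"
        using eventually_ge_at_top[of z] by eventually_elim simp
    qed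
    then show "AE z in H. ((\<lambda>y. indicat_real {..y} z) \<longlongrightarrow> 1) at_top" by simp
  qed (auto split: split_indicator)
  moreover have "(\<integral>z. indicat_real {..y} z \<partial>H) = h y" for y
  proof -
    have "{..y} \<inter> space H = {0..y}" unfolding HH(3) by (rule set_eqI) (simp add: conj_commute)
    then show ?thesis by (simp add: h_def)
  qed
  ultimately show ?thesis by (simp add: prob_space)
qed

text \<open>A level \<open>a\<close> with \<open>0 < h a < 1\<close> gives a positive limiting
  crossing probability \<open>(1 - h a) * h a\<close>. Full support makes every positive level
  eligible; 1 is an arbitrary choice.\<close>

lemma no_meeting_limit: "0 \<le> y \<Longrightarrow> 0 \<le> x \<Longrightarrow> (\<lambda>m. no_meeting m (y, x)) \<longlonglongrightarrow> 0"
  by (rule no_meeting_tendsto_0[OF cdf_limit[of _ 1]]) (simp_all add: h_pos h_less_1)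

section \<open>Bounds for a fixed barrier\<close>

context
  fixes A :: real assumes A: "0 < A"
begin

lemma one_minus_p: "\<P>(\<omega> in P (HA A). X 1 \<omega> \<le> A) = 1 - p A"
proof -
  interpret prob_space "P (HA A)" by (rule prob_space_P[OF HA_prob[OF A]])
  note [measurable] = X_borel[OF HA_prob[OF A]]
  have "{\<omega> \<in> space (P (HA A)). X 1 \<omega> \<le> A} = space (P (HA A)) - {\<omega> \<in> space (P (HA A)). X 1 \<omega> > A}"
    by auto
  then show ?thesis by (simp add: prob_compl p_def[OF A])
qed

lemma p_nonneg: "0 \<le> p A"
  using p_def[OF A] by simp

lemma p_less_1: "p A < 1"
  using quasi_stationary_eigen(1)[OF C2_quasi_stationary[OF A] unit_fun_const[of 0]] one_minus_p by simp

lemma integral_surv_HA: "(\<integral>z. surv A n z \<partial>HA A) = (1 - p A) ^ n"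
proof (induction n)
  case 0
  interpret prob_space "HA A" using in_prob_algebra_halfline(1)[OF HA_prob[OF A]] .
  show ?case by (simp add: prob_space)
next
  case (Suc n)
  show ?case
    using quasi_stationary_eigen(2)[OF C2_quasi_stationary[OF A] unit_fun_surv[of n A]] Suc one_minus_p
    by simp
qed

text \<open>The average over \<open>HA A\<close> cannot exceed the value at 0, the state most
  favourable to survival.\<close>

lemma geometric_le_surv: "(1 - p A) ^ n \<le> surv A n 0"
proof -
  interpret prob_space "HA A" using in_prob_algebra_halfline(1)[OF HA_prob[OF A]] .
  have c: "unit_fun (\<lambda>_. surv A n 0)"
    using unit_funD(2,3)[OF unit_fun_surv[of n A], of 0] by (intro unit_fun_const) auto
  have "(\<integral>z. surv A n z \<partial>HA A) \<le> (\<integral>z. surv A n 0 \<partial>HA A)"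
    by (intro integral_unit_fun_mono[OF HA_prob[OF A] unit_fun_surv c] surv_le_surv_0)
  then show ?thesis by (simp add: integral_surv_HA prob_space)
qed

lemma surv_0_pos: "0 < surv A n 0"
  using geometric_le_surv[of n] p_less_1 zero_less_power[of "1 - p A" n] by linarith

text \<open>For the chain from 0, association places the conditional distribution function above the
  unconditional one at every \<open>n\<close>, and C1 and C2 carry this to the limit. The start 0 is
  admissible in C2 for every \<open>A > 0\<close>.\<close>

lemma h_le_HA: "h y \<le> measure (HA A) {0..y}"
proof (rule LIMSEQ_le[OF cdf_limit[of 0 y]])
  let ?c = "\<lambda>n. \<P>(\<omega> in start P 0. X n \<omega> \<le> y \<bar> exit_time X A \<omega> > enat n)"
  have eq: "?c n = (taboo {..A} ^^ n) (indicator {..y}) 0 / surv A n 0" for n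
    using start_prob_exit[of 0 "{..y}" n A] start_surv[of 0 n A] by (simp add: cond_prob_def)
  show "?c \<longlonglongrightarrow> measure (HA A) {0..y}"
    using C2_limit[OF A, of 0 y] A by (simp add: Collect_le_eq[OF HA_prob[OF A]])
  have anti: "antimono_on {0..} (indicat_real {..y})"
    by (intro monotone_onI) (auto split: split_indicator)
  have "(taboo UNIV ^^ n) (indicator {..y}) 0 \<le> ?c n" for n
    using taboo_pow_ge_product[OF unit_fun_indicator[of "{..y}"] anti, of 0 n A] surv_0_pos[of n]
    by (simp add: eq pos_le_divide_eq)
  then show "\<exists>N. \<forall>n\<ge>N. (taboo UNIV ^^ n) (indicator {..y}) 0 \<le> ?c n" by blast
qed simp

text \<open>\<open>HA A\<close> gives \<open>{0..z}\<close> mass at least \<open>h z\<close>, and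
  every state there survives at least as well as \<open>z\<close>.\<close>

lemma h_times_surv_le_geometric: "0 \<le> z \<Longrightarrow> h z * surv A n z \<le> (1 - p A) ^ n"
proof -
  assume z: "0 \<le> z"
  note HH = in_prob_algebra_halfline[OF HA_prob[OF A]]
  interpret prob_space "HA A" by (rule HH)
  have s: "0 \<le> surv A n z" "surv A n z \<le> 1"
    using unit_funD(2,3)[OF unit_fun_surv[of n A] z] by auto
  have "h z * surv A n z \<le> measure (HA A) {0..z} * surv A n z"
    using h_le_HA s by (intro mult_right_mono)
  also have "\<dots> = (\<integral>w. indicator {..z} w * surv A n z \<partial>HA A)"
  proof -
    have "{..z} \<inter> space (HA A) = {0..z}" unfolding HH(3) by (rule set_eqI) (simp add: conj_commute)
    then show ?thesis by simp
  qed
  also have "\<dots> \<le> (\<integral>w. surv A n w \<partial>HA A)"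
  proof (rule integral_unit_fun_mono[OF HA_prob[OF A]])
    show "unit_fun (\<lambda>w. indicator {..z} w * surv A n z)"
      using s by (intro unit_fun_mult unit_fun_indicator unit_fun_const) auto
    show "indicator {..z} w * surv A n z \<le> surv A n w" if "0 \<le> w" for w
      using monotone_onD[OF antimono_surv[of n A], of w z] unit_funD(2)[OF unit_fun_surv[of n A] that] that z
      by (simp split: split_indicator)
  qed (rule unit_fun_surv)
  finally show ?thesis by (simp add: integral_surv_HA)
qed

text \<open>The probability of staying below \<open>A\<close> for one step decreases with the state,
  so it is at least as large under \<open>HA A\<close> as under the dominating \<open>H\<close>,
  where stationarity makes it \<open>h A\<close>.\<close>

lemma p_le: "p A \<le> 1 - h A"
proof -
  have anti: "antimono_on {0..} (indicat_real {..A})"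
    by (intro monotone_onI) (auto split: split_indicator)
  have u: "unit_fun (indicat_real {..A})" by (intro unit_fun_indicator) simp
  have law: "\<P>(\<omega> in P G. X 1 \<omega> \<le> A) = (\<integral>x. (\<integral>z. indicator {..A} z \<partial>K x) \<partial>G)"
    if "G \<in> space (prob_algebra halfline)" for G
    using prob_marginal[OF that, of "{..A}" 1] by (simp only: taboo_UNIV funpow_simps_right comp_def id_def One_nat_def funpow_0) simp
  have "\<P>(\<omega> in P H. X 1 \<omega> \<le> A) = measure (distr (P H) halfline (X 1)) {0..A}"
    using X_nonneg[OF H_prob]
    by (subst measure_distr[OF X_measurable[OF H_prob]]) (auto simp: sets_halfline intro!: arg_cong[where f="measure (P H)"])
  also have "\<dots> = h A"
    using C1_stationary by (simp add: stationary_def h_def)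
  finally have "h A = (\<integral>x. (\<integral>z. indicator {..A} z \<partial>K x) \<partial>H)" by (simp only: law[OF H_prob])
  also have "\<dots> \<le> (\<integral>x. (\<integral>z. indicator {..A} z \<partial>K x) \<partial>HA A)"
    using h_le_HA
    by (intro integral_le_of_stoch_le HA_prob A H_prob unit_fun_integral u antimono_integral anti) (simp add: h_def)
  also have "\<dots> = 1 - p A" by (simp only: law[OF HA_prob[OF A], symmetric] one_minus_p)
  finally show ?thesis by simp
qed

text \<open>With \<open>p A = 0\<close> the chain from 0 would never exceed \<open>A\<close>, so its
  limit law would live on \<open>[0, A]\<close>, against the full support of
  \<open>H\<close>.\<close>

lemma p_pos: "0 < p A"
proof (rule ccontr)
  assume "\<not> 0 < p A"
  then have "p A = 0" using p_nonneg by simp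
  note r = return_halfline[of 0]
  interpret prob_space "start P 0" unfolding start_def by (rule prob_space_P[OF r]) simp
  have [measurable]: "X n \<in> borel_measurable (start P 0)" for n
    unfolding start_def by (rule X_borel[OF r]) simp
  \<comment> \<open>Only positive times, since survival restrains \<open>X\<close> from time 1
    on.\<close>
  have "1 \<le> (taboo UNIV ^^ Suc n) (indicator {..A}) 0" for n
  proof -
    have "1 \<le> surv A (Suc n) 0" using geometric_le_surv[of "Suc n"] \<open>p A = 0\<close> by simp
    also have "\<dots> = \<P>(\<omega> in start P 0. exit_time X A \<omega> > enat (Suc n))" by (simp add: start_surv del: funpow.simps)
    also have "\<dots> \<le> \<P>(\<omega> in start P 0. X (Suc n) \<omega> \<le> A)"
      by (intro finite_measure_mono) (auto simp: exit_time_gt_iff)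
    also have "\<dots> = (taboo UNIV ^^ Suc n) (indicator {..A}) 0" by (simp add: start_cdf del: funpow.simps)
    finally show ?thesis .
  qed
  then have "1 \<le> h A"
    by (intro LIMSEQ_le_const[OF LIMSEQ_Suc[OF cdf_limit[of 0 A]]]) auto
  then show False using h_less_1[of A] A by simp
qed

end

lemma p_tendsto_0: "(p \<longlongrightarrow> 0) at_top"
proof (rule tendsto_sandwich)
  show "\<forall>\<^sub>F A in at_top. 0 \<le> p A"
    using eventually_gt_at_top[of 0] by eventually_elim (rule p_nonneg)
  show "\<forall>\<^sub>F A in at_top. p A \<le> 1 - h A"
    using eventually_gt_at_top[of 0] by eventually_elim (rule p_le)
  show "((\<lambda>A. 1 - h A) \<longlongrightarrow> 0) at_top"
    using tendsto_diff[OF tendsto_const h_tendsto_1, of 1] by simp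
qed simp

lemma eventually_p_pos: "\<forall>\<^sub>F A in at_top. 0 < p A"
  using eventually_gt_at_top[of 0] by eventually_elim (rule p_pos)

text \<open>The state \<open>z\<close> is fixed before \<open>A\<close>. In the upper bound,
  dropping the factor \<open>h z > 1 - \<delta> / 2\<close> costs \<open>\<delta> / 2\<close> and
  passing from 0 to \<open>z\<close> by the coupling another \<open>\<delta> / 2\<close>. In the
  lower bound, passing from 0 to \<open>x\<close> costs \<open>\<delta>\<close>.\<close>

lemma surv_geometric_uniformly:
  assumes x: "0 \<le> x" and \<delta>: "0 < \<delta>"
  shows "\<forall>\<^sub>F A in at_top. \<forall>n. \<bar>surv A n x - (1 - p A) ^ n\<bar> \<le> \<delta>"
proof -
  have "\<forall>\<^sub>F z in at_top. 1 - \<delta> / 2 < h z"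
    using h_tendsto_1 \<delta> by (intro order_tendstoD) auto
  then have "\<forall>\<^sub>F z in at_top. 0 \<le> z \<and> 1 - \<delta> / 2 < h z"
    using eventually_ge_at_top[of 0] by eventually_elim simp
  then obtain z where z: "0 \<le> z" "1 - \<delta> / 2 < h z"
    using eventually_happens'[OF trivial_limit_at_top_linorder] by blast
  have d2: "0 < \<delta> / 2" using \<delta> by simp
  show ?thesis
    using surv_diff_uniformly_small[OF order_refl x no_meeting_limit[OF order_refl x] \<delta>]
      surv_diff_uniformly_small[OF order_refl z(1) no_meeting_limit[OF order_refl z(1)] d2]
      eventually_gt_at_top[of 0]
  proof eventually_elim
    case (elim A)
    show ?case
    proof
      fix n
      have s: "0 \<le> surv A n z" "surv A n z \<le> 1"
        using unit_funD(2,3)[OF unit_fun_surv[of n A] z(1)] by auto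
      have "(1 - h z) * surv A n z \<le> (\<delta> / 2) * 1"
        using s z h_less_1[OF z(1)] \<delta> by (intro mult_mono) auto
      then have "surv A n z \<le> (1 - p A) ^ n + \<delta> / 2"
        using h_times_surv_le_geometric[OF elim(3) z(1), of n] by (simp add: left_diff_distrib)
      moreover have "surv A n 0 - surv A n x \<le> \<delta>" "surv A n 0 - surv A n z \<le> \<delta> / 2"
        using elim(1,2) by auto
      ultimately show "\<bar>surv A n x - (1 - p A) ^ n\<bar> \<le> \<delta>"
        using geometric_le_surv[OF elim(3), of n] surv_le_surv_0[OF x, of n A] by linarith
    qed
  qed
qed

text \<open>The index moves with \<open>A\<close>, so the comparison with the geometric law has to
  be uniform in \<open>n\<close> before the limit of the latter can be used.\<close>

lemma surv_tendsto_exp: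
  assumes x: "0 \<le> x" and s: "0 \<le> s"
  shows "((\<lambda>A. surv A (nat \<lfloor>s / p A\<rfloor>) x) \<longlongrightarrow> exp (- s)) at_top"
proof -
  have "((\<lambda>A. surv A (nat \<lfloor>s / p A\<rfloor>) x - (1 - p A) ^ nat \<lfloor>s / p A\<rfloor>) \<longlongrightarrow> 0) at_top"
  proof (rule tendstoI)
    fix e :: real assume "0 < e"
    then have "0 < e / 2" by simp
    from surv_geometric_uniformly[OF x this]
    show "\<forall>\<^sub>F A in at_top. dist (surv A (nat \<lfloor>s / p A\<rfloor>) x - (1 - p A) ^ nat \<lfloor>s / p A\<rfloor>) 0 < e"
    proof eventually_elim
      case (elim A)
      then have "\<bar>surv A (nat \<lfloor>s / p A\<rfloor>) x - (1 - p A) ^ nat \<lfloor>s / p A\<rfloor>\<bar> \<le> e / 2" by blast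
      then show ?case using \<open>0 < e\<close> by (simp add: dist_real_def)
    qed
  qed
  from tendsto_add[OF this geometric_tendsto_exp[OF p_tendsto_0 eventually_p_pos s]]
  show ?thesis by simp
qed

lemma surv_mult_le_power: "surv A (q * L) 0 \<le> surv A L 0 ^ q"
proof (induction q)
  case (Suc q)
  have "surv A (L + q * L) 0 \<le> surv A L 0 * surv A (q * L) 0" by (rule surv_add_le) simp
  also have "\<dots> \<le> surv A L 0 * surv A L 0 ^ q"
    using Suc unit_funD(2)[OF unit_fun_surv[of L A], of 0] by (intro mult_left_mono) auto
  finally show ?case by simp
qed simp

text \<open>Time is cut into blocks of length \<open>L = nat \<lfloor>1 / p A\<rfloor>\<close>. From
  0 a block is survived with probability tending to \<open>exp (- 1) < exp (- r)\<close>, and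
  \<open>p A * L \<le> 1\<close> makes the number of full blocks at least
  \<open>p A * n - 1\<close>; the prefactor \<open>exp r\<close> pays for the incomplete last
  block.\<close>

lemma surv_exponential_bound:
  assumes r: "0 < r" "r < 1"
  shows "\<forall>\<^sub>F A in at_top. \<forall>n. surv A n 0 \<le> exp r * exp (- r * (p A * n))"
proof -
  have "\<forall>\<^sub>F A in at_top. surv A (nat \<lfloor>1 / p A\<rfloor>) 0 < exp (- r)"
    using surv_tendsto_exp[of 0 1] r by (intro order_tendstoD) auto
  then show ?thesis
    using eventually_gt_at_top[of 0]
  proof eventually_elim
    case (elim A)
    note p = p_pos[OF elim(2)] p_less_1[OF elim(2)]
    define L where "L = nat \<lfloor>1 / p A\<rfloor>"
    have "1 \<le> \<lfloor>1 / p A\<rfloor>" using p by (simp add: le_floor_iff)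
    then have L: "0 < L" "real L = of_int \<lfloor>1 / p A\<rfloor>" by (simp_all only: L_def)
    have "real L \<le> 1 / p A" unfolding L(2) by (rule of_int_floor_le)
    then have pL: "p A * L \<le> 1" using p by (simp add: pos_le_divide_eq mult.commute)
    show ?case
    proof
      fix n
      define q where "q = n div L"
      have n: "n = q * L + n mod L" by (simp add: q_def)
      have b: "0 \<le> surv A m 0" "surv A m 0 \<le> 1" for m
        using unit_funD(2,3)[OF unit_fun_surv[of m A], of 0] by auto
      have "surv A n 0 \<le> surv A (q * L) 0 * surv A (n mod L) 0"
        by (subst (1) n) (rule surv_add_le, simp)
      also have "\<dots> \<le> surv A (q * L) 0" using b by (simp add: mult_left_le)
      also have "\<dots> \<le> surv A L 0 ^ q" by (rule surv_mult_le_power)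
      also have "\<dots> \<le> exp (- r) ^ q"
        using elim(1) b by (intro power_mono) (auto simp: L_def)
      also have "\<dots> = exp (- r * q)" using exp_of_nat_mult[of q "- r"] by (simp add: mult.commute)
      also have "\<dots> \<le> exp (r + - r * (p A * n))"
      proof -
        have "n \<le> q * L + L" using n mod_less_divisor[OF L(1), of n] by linarith
        then have "real n \<le> (real q + 1) * L"
          using of_nat_mono[of n "q * L + L", where 'a=real] by (simp add: algebra_simps)
        then have "p A * n \<le> p A * ((real q + 1) * L)" using p by (intro mult_left_mono) auto
        also have "\<dots> = (real q + 1) * (p A * L)" by simp
        also have "\<dots> \<le> (real q + 1) * 1" using pL by (intro mult_left_mono) auto
        finally have "r * (p A * n) \<le> r * (real q + 1)" using r by (intro mult_left_mono) auto
        then show ?thesis by (simp add: algebra_simps)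
      qed
      finally show "surv A n 0 \<le> exp r * exp (- r * (p A * n))" by (simp only: exp_add)
    qed
  qed
qed

end

section \<open>Limits of the scaled exit time\<close>

context exit_chain
begin

context
  fixes x :: real assumes x: "0 \<le> x"
begin

lemma prob_space_start: "prob_space (start P x)"
  unfolding start_def by (rule prob_space_P[OF return_halfline[OF x]])

lemma exit_time_start_measurable: "exit_time X A \<in> start P x \<rightarrow>\<^sub>M count_space UNIV"
  unfolding start_def by (rule exit_time_measurable[OF return_halfline[OF x]])

lemma exit_time_real_start_measurable: "exit_time_real X A \<in> borel_measurable (start P x)"
  unfolding start_def by (rule exit_time_real_measurable[OF return_halfline[OF x]])

text \<open>Never leaving is contained in every survival event, and the exponential bound, taken at
  the arbitrary rate \<open>1 / 2\<close>, sends their probabilities to 0.\<close>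

lemma eventually_exit_time_finite: "\<forall>\<^sub>F A in at_top. AE \<omega> in start P x. exit_time X A \<omega> \<noteq> \<infinity>"
  using surv_exponential_bound[of "1 / 2", simplified] eventually_p_pos
proof eventually_elim
  case (elim A)
  interpret prob_space "start P x" by (rule prob_space_start)
  note [measurable] = exit_time_start_measurable
  have le: "prob {\<omega> \<in> space (start P x). exit_time X A \<omega> = \<infinity>} \<le> exp (1 / 2) * exp (- (p A / 2)) ^ n" for n
  proof -
    have "prob {\<omega> \<in> space (start P x). exit_time X A \<omega> = \<infinity>} \<le> \<P>(\<omega> in start P x. exit_time X A \<omega> > enat n)"
      by (intro finite_measure_mono) auto
    also have "\<dots> \<le> surv A n 0" using start_surv[OF x] surv_le_surv_0[OF x] by simp
    also have "\<dots> \<le> exp (1 / 2) * exp (- (p A * n / 2))" using elim(1) by blast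
    also have "exp (- (p A * n / 2)) = exp (- (p A / 2)) ^ n"
      using exp_of_nat_mult[of n "- (p A / 2)"] by (simp add: mult.commute)
    finally show ?thesis .
  qed
  have lim: "(\<lambda>n. exp (1 / 2) * exp (- (p A / 2)) ^ n) \<longlonglongrightarrow> exp (1 / 2) * 0"
    using elim(2) by (intro tendsto_mult_left LIMSEQ_power_zero) simp
  have "prob {\<omega> \<in> space (start P x). exit_time X A \<omega> = \<infinity>} \<le> exp (1 / 2) * 0"
    by (rule LIMSEQ_le_const[OF lim]) (use le in blast)
  then have "prob {\<omega> \<in> space (start P x). exit_time X A \<omega> = \<infinity>} = 0"
    using measure_nonneg[of "start P x"] by (intro antisym) simp_all
  then show ?case by (subst (asm) prob_eq_0) auto
qed

text \<open>For an integer \<open>k\<close>, \<open>s < p A * k\<close> means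
  \<open>\<lfloor>s / p A\<rfloor> < k\<close>. Almost sure finiteness matters because
  \<open>the_enat\<close> has no meaningful value at infinity.\<close>

lemma scaled_exit_tail:
  assumes fin: "AE \<omega> in start P x. exit_time X A \<omega> \<noteq> \<infinity>" and p: "0 < p A" and s: "0 \<le> s"
  shows "\<P>(\<omega> in start P x. s < p A * exit_time_real X A \<omega>) = surv A (nat \<lfloor>s / p A\<rfloor>) x"
proof -
  note [measurable] = exit_time_start_measurable exit_time_real_start_measurable
  have "\<P>(\<omega> in start P x. s < p A * exit_time_real X A \<omega>)
      = \<P>(\<omega> in start P x. exit_time X A \<omega> > enat (nat \<lfloor>s / p A\<rfloor>))"
  proof (intro measure_eq_AE)
    show "AE \<omega> in start P x. \<omega> \<in> {\<omega> \<in> space (start P x). s < p A * exit_time_real X A \<omega>}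
        \<longleftrightarrow> \<omega> \<in> {\<omega> \<in> space (start P x). exit_time X A \<omega> > enat (nat \<lfloor>s / p A\<rfloor>)}"
      using fin
    proof eventually_elim
      case (elim \<omega>)
      then obtain k where k: "exit_time X A \<omega> = enat k" by auto
      have "s < p A * k \<longleftrightarrow> s / p A < k" using p by (simp add: pos_divide_less_eq mult.commute)
      also have "\<dots> \<longleftrightarrow> \<lfloor>s / p A\<rfloor> < int k" by (simp add: floor_less_iff)
      also have "\<dots> \<longleftrightarrow> nat \<lfloor>s / p A\<rfloor> < k" using s p by (simp add: nat_less_iff)
      finally show ?case using k by (simp add: exit_time_real_def)
    qed
  qed measurable
  then show ?thesis by (simp add: start_surv[OF x])
qed

lemma scaled_exit_tail_limit:
  assumes s: "0 \<le> s"
  shows "((\<lambda>A. \<P>(\<omega> in start P x. s < p A * exit_time_real X A \<omega>)) \<longlongrightarrow> exp (- s)) at_top"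
  using surv_tendsto_exp[OF x s]
proof (rule Lim_transform_eventually)
  show "\<forall>\<^sub>F A in at_top. surv A (nat \<lfloor>s / p A\<rfloor>) x = \<P>(\<omega> in start P x. s < p A * exit_time_real X A \<omega>)"
    using eventually_exit_time_finite eventually_p_pos
    by eventually_elim (use scaled_exit_tail s in simp)
qed

lemma scaled_exit_tail_bound:
  assumes r: "0 < r" "r < 1"
  shows "\<forall>\<^sub>F A in at_top. \<forall>s\<ge>0.
    \<P>(\<omega> in start P x. s < p A * exit_time_real X A \<omega>) \<le> exp (2 * r) * exp (- r * s)"
  using surv_exponential_bound[OF r] eventually_exit_time_finite eventually_gt_at_top[of 0]
proof eventually_elim
  case (elim A)
  note p = p_pos[OF elim(3)] p_less_1[OF elim(3)]
  show ?case
  proof (intro allI impI)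
    fix s :: real assume s: "0 \<le> s"
    define n where "n = nat \<lfloor>s / p A\<rfloor>"
    have "real n = of_int \<lfloor>s / p A\<rfloor>" using s p by (simp add: n_def)
    \<comment> \<open>Rounding down loses at most one step, that is at most \<open>p A < 1\<close>
      in scaled time; this is the origin of the second factor \<open>exp r\<close> in
      \<open>exp (2 * r)\<close>.\<close>
    then have "s / p A \<le> n + 1" by linarith
    then have "s \<le> p A * n + 1" using p by (simp add: pos_divide_le_eq algebra_simps)
    then have "r * s \<le> r * (p A * n + 1)" using r by (intro mult_left_mono) auto
    then have e: "r + - r * (p A * n) \<le> 2 * r + - r * s" by (simp add: algebra_simps)
    have "\<P>(\<omega> in start P x. s < p A * exit_time_real X A \<omega>) = surv A n x"
      unfolding n_def by (rule scaled_exit_tail[OF elim(2) p(1) s])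
    also have "\<dots> \<le> surv A n 0" by (rule surv_le_surv_0[OF x])
    also have "\<dots> \<le> exp (r + - r * (p A * n))" using elim(1) unfolding exp_add by blast
    also have "\<dots> \<le> exp (2 * r + - r * s)" using e by simp
    finally show "\<P>(\<omega> in start P x. s < p A * exit_time_real X A \<omega>) \<le> exp (2 * r) * exp (- r * s)"
      unfolding exp_add .
  qed
qed

lemma scaled_exit_moment_limit:
  fixes G g :: "real \<Rightarrow> real"
  assumes deriv: "\<And>s. (G has_real_derivative g s) (at s)" and cont: "\<And>s. isCont g s"
    and growth: "\<And>s. 0 \<le> s \<Longrightarrow> \<bar>g s\<bar> \<le> B * exp (t * s)" and t: "t < 1"
  shows "\<forall>\<^sub>F A in at_top. integrable (start P x) (\<lambda>\<omega>. G (p A * exit_time_real X A \<omega>))"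
    and "((\<lambda>A. \<integral>\<omega>. G (p A * exit_time_real X A \<omega>) \<partial>start P x)
      \<longlongrightarrow> G 0 + (\<integral>s. indicator {0..} s * g s * exp (- s) \<partial>lborel)) at_top"
proof -
  \<comment> \<open>The rate must exceed \<open>t\<close> for domination and lie strictly between 0
    and 1 for the tail bound; \<open>t\<close> itself may be negative.\<close>
  obtain r where r: "0 < r" "r < 1" "t < r"
    using dense[of "max 0 t" 1] t by auto
  have m: "(\<lambda>\<omega>. p A * exit_time_real X A \<omega>) \<in> borel_measurable (start P x)" for A
    using exit_time_real_start_measurable by simp
  have nonneg: "\<forall>\<^sub>F A in at_top. \<forall>\<omega>\<in>space (start P x). 0 \<le> p A * exit_time_real X A \<omega>"
    using eventually_p_pos by eventually_elim (simp add: exit_time_real_def)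
  note * = tail_moment_limit[OF prob_space_start m nonneg scaled_exit_tail_limit
      scaled_exit_tail_bound[OF r(1,2)] deriv cont growth r(3)]
  show "\<forall>\<^sub>F A in at_top. integrable (start P x) (\<lambda>\<omega>. G (p A * exit_time_real X A \<omega>))"
    by (rule *(1))
  show "((\<lambda>A. \<integral>\<omega>. G (p A * exit_time_real X A \<omega>) \<partial>start P x)
      \<longlongrightarrow> G 0 + (\<integral>s. indicator {0..} s * g s * exp (- s) \<partial>lborel)) at_top"
    by (rule *(2))
qed

lemma scaled_exit_weak_limit:
  "weak_conv_along (\<lambda>A. distr (start P x) borel (\<lambda>\<omega>. p A * exit_time_real X A \<omega>))
     (density lborel (exponential_density 1)) at_top"
  unfolding weak_conv_along_def
proof (intro allI impI)
  fix s :: real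
  interpret prob_space "start P x" by (rule prob_space_start)
  note [measurable] = exit_time_real_start_measurable
  let ?Y = "\<lambda>A \<omega>. p A * exit_time_real X A \<omega>"
  have lim: "cdf (density lborel (exponential_density 1)) s = (if 0 \<le> s then 1 - exp (- s) else 0)"
    using emeasure_erlang_density[of 1 0 s] by (simp add: cdf_def measure_def erlang_CDF_0)
  have cdf: "cdf (distr (start P x) borel (?Y A)) s = \<P>(\<omega> in start P x. ?Y A \<omega> \<le> s)" for A
    by (auto simp: cdf_def measure_distr intro!: arg_cong[where f=prob])
  have compl: "\<P>(\<omega> in start P x. ?Y A \<omega> \<le> s) = 1 - \<P>(\<omega> in start P x. s < ?Y A \<omega>)" for A
  proof -
    have "{\<omega> \<in> space (start P x). ?Y A \<omega> \<le> s} = space (start P x) - {\<omega> \<in> space (start P x). s < ?Y A \<omega>}"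
      by auto
    then show ?thesis by (simp add: prob_compl)
  qed
  show "((\<lambda>A. cdf (distr (start P x) borel (?Y A)) s) \<longlongrightarrow> cdf (density lborel (exponential_density 1)) s) at_top"
  proof (cases "0 \<le> s")
    case True
    then show ?thesis
      unfolding cdf compl lim using tendsto_diff[OF tendsto_const scaled_exit_tail_limit[OF True], of 1] by simp
  next
    case False
    \<comment> \<open>The scaled time is known to be nonnegative only once \<open>p A > 0\<close>;
      at \<open>A \<le> 0\<close> the function \<open>p\<close> is arbitrary.\<close>
    have "\<forall>\<^sub>F A in at_top. 0 = \<P>(\<omega> in start P x. ?Y A \<omega> \<le> s)"
      using eventually_p_pos
    proof eventually_elim
      case (elim A)
      have "0 \<le> ?Y A \<omega>" for \<omega> using elim by (simp add: exit_time_real_def)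
      then have "{\<omega> \<in> space (start P x). ?Y A \<omega> \<le> s} = {}"
        using False by (auto simp: not_le intro: less_le_trans)
      then show ?case by (simp only: measure_empty)
    qed
    from Lim_transform_eventually[OF tendsto_const this] False
    show ?thesis unfolding cdf lim by simp
  qed
qed

lemma scaled_exit_mgf_limit:
  assumes t: "t < 1"
  shows "\<forall>\<^sub>F A in at_top. integrable (start P x) (\<lambda>\<omega>. exp (t * (p A * exit_time_real X A \<omega>)))"
    and "((\<lambda>A. \<integral>\<omega>. exp (t * (p A * exit_time_real X A \<omega>)) \<partial>start P x) \<longlongrightarrow> 1 / (1 - t)) at_top"
proof -
  have d: "((\<lambda>s. exp (t * s)) has_real_derivative t * exp (t * s)) (at s)" for s
    by (auto intro!: derivative_eq_intros)
  have c: "isCont (\<lambda>s. t * exp (t * s)) s" for s by simp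
  have g: "\<bar>t * exp (t * s)\<bar> \<le> \<bar>t\<bar> * exp (t * s)" for s by (simp add: abs_mult)
  note * = scaled_exit_moment_limit[OF d c g t]
  show "\<forall>\<^sub>F A in at_top. integrable (start P x) (\<lambda>\<omega>. exp (t * (p A * exit_time_real X A \<omega>)))"
    by (rule *(1))
  have "(\<integral>s. indicator {0..} s * (t * exp (t * s)) * exp (- s) \<partial>lborel)
      = (\<integral>s. t * (indicator {0..} s * (s ^ 0 * exp (- (1 - t) * s))) \<partial>lborel)"
    by (intro Bochner_Integration.integral_cong) (auto simp: algebra_simps simp flip: exp_add)
  also have "\<dots> = t * (1 / (1 - t))"
    using has_bochner_integral_exp_power[of "1 - t" 0] t by (simp add: has_bochner_integral_iff)
  \<comment> \<open>The value at 0 plus the tail integral is \<open>1 + t / (1 - t)\<close>.\<close>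
  finally have "exp (t * 0) + (\<integral>s. indicator {0..} s * (t * exp (t * s)) * exp (- s) \<partial>lborel) = 1 / (1 - t)"
    using t by (simp add: field_simps)
  with *(2) show "((\<lambda>A. \<integral>\<omega>. exp (t * (p A * exit_time_real X A \<omega>)) \<partial>start P x) \<longlongrightarrow> 1 / (1 - t)) at_top"
    by simp
qed

lemma scaled_exit_mean_limit:
  shows "\<forall>\<^sub>F A in at_top. integrable (start P x) (\<lambda>\<omega>. p A * exit_time_real X A \<omega>)"
    and "((\<lambda>A. \<integral>\<omega>. p A * exit_time_real X A \<omega> \<partial>start P x) \<longlongrightarrow> 1) at_top"
proof -
  have d: "((\<lambda>s. s) has_real_derivative 1) (at s)" for s :: real by simp
  have c: "isCont (\<lambda>s. 1 :: real) s" for s :: real by simp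
  have g: "\<bar>1 :: real\<bar> \<le> 1 * exp (0 * s)" for s :: real by simp
  note * = scaled_exit_moment_limit[OF d c g zero_less_one]
  show "\<forall>\<^sub>F A in at_top. integrable (start P x) (\<lambda>\<omega>. p A * exit_time_real X A \<omega>)"
    by (rule *(1))
  have "(\<integral>s. indicator {0..} s * 1 * exp (- s) \<partial>lborel) = (1 :: real)"
    using has_bochner_integral_exp_power[of 1 0] by (simp add: has_bochner_integral_iff)
  with *(2) show "((\<lambda>A. \<integral>\<omega>. p A * exit_time_real X A \<omega> \<partial>start P x) \<longlongrightarrow> 1) at_top"
    by simp
qed

lemma scaled_exit_second_moment_limit:
  shows "\<forall>\<^sub>F A in at_top. integrable (start P x) (\<lambda>\<omega>. (p A * exit_time_real X A \<omega>)\<^sup>2)"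
    and "((\<lambda>A. \<integral>\<omega>. (p A * exit_time_real X A \<omega>)\<^sup>2 \<partial>start P x) \<longlongrightarrow> 2) at_top"
proof -
  have d: "((\<lambda>s. s\<^sup>2) has_real_derivative 2 * s) (at s)" for s :: real
    by (auto intro!: derivative_eq_intros)
  have c: "isCont (\<lambda>s. 2 * s) s" for s :: real by simp
  \<comment> \<open>The constant comes from \<open>1 + s / 2 \<le> exp (s / 2)\<close>; any growth
    rate strictly between 0 and 1 would serve, with its own constant.\<close>
  have g: "\<bar>2 * s\<bar> \<le> 4 * exp (1 / 2 * s)" if "0 \<le> s" for s :: real
  proof -
    have "1 + 1 / 2 * s \<le> exp (1 / 2 * s)" by (rule exp_ge_add_one_self)
    with that show ?thesis by linarith
  qed
  have t: "1 / 2 < (1 :: real)" by simp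
  note * = scaled_exit_moment_limit[OF d c g t]
  show "\<forall>\<^sub>F A in at_top. integrable (start P x) (\<lambda>\<omega>. (p A * exit_time_real X A \<omega>)\<^sup>2)"
    by (rule *(1))
  have "(\<integral>s. indicator {0..} s * (2 * s :: real) * exp (- s) \<partial>lborel)
      = (\<integral>s. 2 * (indicator {0..} s * (s ^ 1 * exp (- 1 * s))) \<partial>lborel)"
    by (intro Bochner_Integration.integral_cong) auto
  also have "\<dots> = (2 :: real)"
    using has_bochner_integral_exp_power[of 1 1] unfolding has_bochner_integral_iff
    by (subst integral_mult_right_zero) simp
  finally have "(\<integral>s. indicator {0..} s * (2 * s) * exp (- s) \<partial>lborel) = (2 :: real)" .
  with *(2) show "((\<lambda>A. \<integral>\<omega>. (p A * exit_time_real X A \<omega>)\<^sup>2 \<partial>start P x) \<longlongrightarrow> 2) at_top"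
    by simp
qed

lemma eventually_integrable_exit_time: "\<forall>\<^sub>F A in at_top. integrable (start P x) (exit_time_real X A)"
  using scaled_exit_mean_limit(1) eventually_p_pos
proof eventually_elim
  case (elim A)
  from integrable_mult_right[OF elim(1), of "1 / p A"] elim(2) show ?case by simp
qed

lemma scaled_exit_variance_limit:
  "((\<lambda>A. prob_space.variance (start P x) (\<lambda>\<omega>. p A * exit_time_real X A \<omega>)) \<longlongrightarrow> 1) at_top"
proof -
  interpret prob_space "start P x" by (rule prob_space_start)
  have "((\<lambda>A. (\<integral>\<omega>. (p A * exit_time_real X A \<omega>)\<^sup>2 \<partial>start P x)
      - (\<integral>\<omega>. p A * exit_time_real X A \<omega> \<partial>start P x)\<^sup>2) \<longlongrightarrow> 2 - 1\<^sup>2) at_top"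
    by (intro tendsto_diff tendsto_power scaled_exit_mean_limit scaled_exit_second_moment_limit)
  then have "((\<lambda>A. (\<integral>\<omega>. (p A * exit_time_real X A \<omega>)\<^sup>2 \<partial>start P x)
      - (\<integral>\<omega>. p A * exit_time_real X A \<omega> \<partial>start P x)\<^sup>2) \<longlongrightarrow> 1) at_top" by simp
  then show ?thesis
  proof (rule Lim_transform_eventually)
    show "\<forall>\<^sub>F A in at_top. (\<integral>\<omega>. (p A * exit_time_real X A \<omega>)\<^sup>2 \<partial>start P x)
      - (\<integral>\<omega>. p A * exit_time_real X A \<omega> \<partial>start P x)\<^sup>2
      = variance (\<lambda>\<omega>. p A * exit_time_real X A \<omega>)"
      using scaled_exit_mean_limit(1) scaled_exit_second_moment_limit(1)
      by eventually_elim (rule variance_eq[symmetric])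
  qed
qed

end

end

theorem theorem1:
  fixes K :: "real \<Rightarrow> real measure"
    and P :: "real measure \<Rightarrow> 'w measure"
    and X :: "nat \<Rightarrow> 'w \<Rightarrow> real"
    and H :: "real measure"
    and HA :: "real \<Rightarrow> real measure"
    and p :: "real \<Rightarrow> real"
  assumes markov: "markov_process K P X"
    and monotone: "stochastically_monotone P X"
    and harris: "harris_recurrent P X"
    and C1_stationary: "stationary P X H"
    and C1_limit: "\<And>x y. x \<ge> 0 \<Longrightarrow>
          (\<lambda>n. \<P>(\<omega> in start P x. X n \<omega> \<le> y)) \<longlonglongrightarrow> \<P>(z in H. z \<le> y)"
    and C1_support: "measure_support H = {0..}"
    and C2_quasi_stationary: "\<And>A. A > 0 \<Longrightarrow> quasi_stationary P X A (HA A)"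
    and C2_limit: "\<And>A x y. A > 0 \<Longrightarrow> 0 \<le> x \<Longrightarrow> x < A \<Longrightarrow>
          (\<lambda>n. \<P>(\<omega> in start P x. X n \<omega> \<le> y \<bar> exit_time X A \<omega> > enat n))
            \<longlonglongrightarrow> \<P>(z in HA A. z \<le> y)"
    and p_def: "\<And>A. A > 0 \<Longrightarrow> p A = \<P>(\<omega> in P (HA A). X 1 \<omega> > A)"
  shows
    "(\<forall>x\<ge>0.
       (\<forall>\<^sub>F A in at_top. AE \<omega> in start P x. exit_time X A \<omega> \<noteq> \<infinity>) \<and>
       weak_conv_along (\<lambda>A. distr (start P x) borel (\<lambda>\<omega>. p A * exit_time_real X A \<omega>))
         (density lborel (exponential_density 1)) at_top)
     \<and>
     (\<forall>x\<ge>0.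
       (\<forall>t<1.
          (\<forall>\<^sub>F A in at_top. integrable (start P x) (\<lambda>\<omega>. exp (t * (p A * exit_time_real X A \<omega>)))) \<and>
          ((\<lambda>A. prob_space.expectation (start P x) (\<lambda>\<omega>. exp (t * (p A * exit_time_real X A \<omega>))))
             \<longlongrightarrow> 1 / (1 - t)) at_top) \<and>
       (\<forall>\<^sub>F A in at_top. integrable (start P x) (exit_time_real X A)) \<and>
       ((\<lambda>A. p A * prob_space.expectation (start P x) (exit_time_real X A)) \<longlongrightarrow> 1) at_top \<and>
       (\<forall>\<^sub>F A in at_top. integrable (start P x) (\<lambda>\<omega>. (p A * exit_time_real X A \<omega>)\<^sup>2)) \<and>
       ((\<lambda>A. prob_space.variance (start P x) (\<lambda>\<omega>. p A * exit_time_real X A \<omega>)) \<longlongrightarrow> 1) at_top)"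
proof -
  interpret markov_chain K P X
    using markov unfolding markov_process_def by unfold_locales auto
  \<comment> \<open>A second stage is needed because the monotonicity of \<open>K\<close> is derived
    from the process inside the first interpretation before it can discharge the kernel assumption
    here.\<close>
  interpret exit_chain K P X H HA p
    by unfold_locales (fact kernel_stoch_mono[OF monotone] C1_stationary C1_limit C1_support
      C2_quasi_stationary C2_limit p_def)+
  show ?thesis
  proof (intro conjI allI impI)
    fix x :: real assume x: "0 \<le> x"
    show "((\<lambda>A. p A * prob_space.expectation (start P x) (exit_time_real X A)) \<longlongrightarrow> 1) at_top"
      using scaled_exit_mean_limit(2)[OF x] by simp
  qed (fact eventually_exit_time_finite scaled_exit_weak_limit scaled_exit_mgf_limit
      eventually_integrable_exit_time scaled_exit_second_moment_limit(1) scaled_exit_variance_limit)+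
qed

end
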